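(* Let $N\geq 2$, $f\in C^1(\mathbb{R})$, and let $u$ be a radial stable solution (not necessarily bounded) of $-\Delta u=f(u)$ in $\mathbb{R}^N\setminus B_1$. Then the limit $u_\infty:=\lim_{r\to\infty}u(r)\in[-\infty,+\infty]$ exists, and $u$ satisfies either $(L)$ or $(S)$ (exactly one of them), where: $(L)$ There exist $M>0$ and $r_0\geq 1$ such that - $|u(r)|\geq M r^{-N/2+\sqrt{N-1}+2}$ for all $r\geq r_0$, if $2\leq N\leq 9$; - $|u(r)|\geq M\log(r)$ for all $r\geq r_0$, if $N=10$; - $|u(r)-u_\infty|\geq M r^{-N/2+\sqrt{N-1}+2}$ for all $r\geq r_0$, if $N\geq 11$. $(S)$ There exists $M>0$ such that - $|u(r)|\leq M\log(r)$ for all $r\geq 2$, if $N=2$; - $|u(r)-u_\infty|\leq M r^{-N/2-\sqrt{N-1}+2}$ for all $r\geq 1$, if $N\geq 3$.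
   Context: $B_1$ is the open unit ball of $\mathbb{R}^N$, so $\mathbb{R}^N\setminus B_1=\{x:|x|\geq 1\}$. Solutions are classical: $u\in C^2(\mathbb{R}^N\setminus B_1)$ (up to the boundary). A solution $u$ of $-\Delta u=f(u)$ in $\mathbb{R}^N\setminus B_1$ is called stable if $\int_{\mathbb{R}^N\setminus\overline{B_1}}\left(|\nabla v|^2-f'(u)v^2\right)dx\geq 0$ for every $v\in C^1(\mathbb{R}^N\setminus\overline{B_1})$ with compact support in $\mathbb{R}^N\setminus\overline{B_1}$. For radial $u$ one writes $u(r)$ for $u(x)$ with $r=|x|$. When $u_\infty=\pm\infty$, one has $|u(r)-u_\infty|=+\infty$; thus for $N\geq 11$ the inequality in $(L)$ holds vacuously if $u_\infty=\pm\infty$, while for $N\geq 3$ condition $(S)$ implicitly requires $u_\infty\in\mathbb{R}$. *)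

theory Defs
  imports "HOL-Analysis.Analysis"
begin

text \<open>
  Derivatives are taken within a set \<open>S\<close>, which is meant to be either open or the closure of an
  open set with smooth boundary; there the derivative within \<open>S\<close> is unique. For open \<open>S\<close> this is
  the ordinary derivative. For closed \<open>S\<close> it makes \<open>C1_on S\<close> and \<open>C2_on S\<close> the spaces of functions
  that are continuously differentiable up to the boundary.
\<close>

definition grad_on :: "(real ^ 'n) set \<Rightarrow> (real ^ 'n \<Rightarrow> real) \<Rightarrow> real ^ 'n \<Rightarrow> real ^ 'n" where
  "grad_on S u x = (\<chi> i. frechet_derivative u (at x within S) (axis i 1))"

definition C1_on :: "(real ^ 'n) set \<Rightarrow> (real ^ 'n \<Rightarrow> real) \<Rightarrow> bool" where
  "C1_on S u \<longleftrightarrow> u differentiable_on S \<and> continuous_on S (grad_on S u)"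

definition C2_on :: "(real ^ 'n) set \<Rightarrow> (real ^ 'n \<Rightarrow> real) \<Rightarrow> bool" where
  "C2_on S u \<longleftrightarrow> C1_on S u \<and> (\<forall>i. C1_on S (\<lambda>x. grad_on S u x $ i))"

definition laplacian_on :: "(real ^ 'n) set \<Rightarrow> (real ^ 'n \<Rightarrow> real) \<Rightarrow> real ^ 'n \<Rightarrow> real" where
  "laplacian_on S u x = (\<Sum>i\<in>UNIV. grad_on S (\<lambda>y. grad_on S u y $ i) x $ i)"

definition classical_solution_on ::
    "(real ^ 'n) set \<Rightarrow> (real \<Rightarrow> real) \<Rightarrow> (real ^ 'n \<Rightarrow> real) \<Rightarrow> bool" where
  "classical_solution_on S f u \<longleftrightarrow>
     C2_on S u \<and> (\<forall>x\<in>S. - laplacian_on S u x = f (u x))"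

text \<open>
  Values of a test function outside the open set \<open>\<Omega>\<close> are irrelevant. The integrand is continuous
  with compact support in \<open>\<Omega>\<close>, hence integrable, whenever \<open>u\<close> is continuous on \<open>\<Omega>\<close> and \<open>f\<close> is \<open>C\<^sup>1\<close>.
\<close>

definition test_function_on :: "(real ^ 'n) set \<Rightarrow> (real ^ 'n \<Rightarrow> real) \<Rightarrow> bool" where
  "test_function_on \<Omega> v \<longleftrightarrow>
     C1_on \<Omega> v \<and> compact (closure {x \<in> \<Omega>. v x \<noteq> 0}) \<and> closure {x \<in> \<Omega>. v x \<noteq> 0} \<subseteq> \<Omega>"

definition stable_on ::
    "(real ^ 'n) set \<Rightarrow> (real \<Rightarrow> real) \<Rightarrow> (real ^ 'n \<Rightarrow> real) \<Rightarrow> bool" where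
  "stable_on \<Omega> f u \<longleftrightarrow>
     (\<forall>v. test_function_on \<Omega> v \<longrightarrow>
        (LINT x:\<Omega>|lborel. (norm (grad_on \<Omega> v x))\<^sup>2 - deriv f (u x) * (v x)\<^sup>2) \<ge> 0)"

text \<open>
  In the two alternatives \<open>w\<close> is the radial profile of the solution and \<open>l\<close> is its limit at infinity.
  Differences with \<open>l\<close> are taken in \<^typ>\<open>ereal\<close>, where \<open>\<bar>ereal (w r) - l\<bar> = \<infinity>\<close> if \<open>l\<close> is infinite.
\<close>

definition cond_L :: "nat \<Rightarrow> (real \<Rightarrow> real) \<Rightarrow> ereal \<Rightarrow> bool" where
  "cond_L N w l \<longleftrightarrow>
     (\<exists>M>0. \<exists>r0\<ge>1.
        (2 \<le> N \<and> N \<le> 9 \<longrightarrow>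
           (\<forall>r\<ge>r0. \<bar>w r\<bar> \<ge> M * r powr (- real N / 2 + sqrt (real N - 1) + 2))) \<and>
        (N = 10 \<longrightarrow>
           (\<forall>r\<ge>r0. \<bar>w r\<bar> \<ge> M * ln r)) \<and>
        (N \<ge> 11 \<longrightarrow>
           (\<forall>r\<ge>r0. \<bar>ereal (w r) - l\<bar> \<ge>
              ereal (M * r powr (- real N / 2 + sqrt (real N - 1) + 2)))))"

definition cond_S :: "nat \<Rightarrow> (real \<Rightarrow> real) \<Rightarrow> ereal \<Rightarrow> bool" where
  "cond_S N w l \<longleftrightarrow>
     (\<exists>M>0.
        (N = 2 \<longrightarrow>
           (\<forall>r\<ge>2. \<bar>w r\<bar> \<le> M * ln r)) \<and>
        (N \<ge> 3 \<longrightarrow>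
           (\<forall>r\<ge>1. \<bar>ereal (w r) - l\<bar> \<le>
              ereal (M * r powr (- real N / 2 - sqrt (real N - 1) + 2)))))"

end

theory Submission
  imports Defs
begin

text \<open>
  In the variable \<open>t = ln r\<close> the derivative \<open>y t = w' (exp t)\<close> of the radial profile solves the
  linearised equation with an additional term \<open>(N - 1) y\<close>. Testing stability with \<open>y * \<eta>\<close> therefore
  gives \<open>\<integral> Q (\<eta>'\<^sup>2 - s\<^sup>2 \<eta>\<^sup>2) \<ge> 0\<close> for \<open>Q t = exp ((N - 2) t) (y t)\<^sup>2\<close>, \<open>s = sqrt (N - 1)\<close> and every
  \<open>\<eta>\<close> with compact support in \<open>(0, \<infinity>)\<close>; testing with \<open>y\<close> cut off between two of its zeros shows that
  \<open>w\<close> is eventually monotone. Consider the \<open>\<eta>\<close> that vanish at some positive time and are stopped at a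
  later time, at an arbitrary value. If one of them has negative energy, continuing it by a multiple
  of \<open>exp (- s t)\<close> (at no cost) and then by the optimal descent to \<open>0\<close> on \<open>[T, T + 1]\<close> yields
  \<open>\<integral>\<^sub>T\<^sup>T\<^sup>+\<^sup>1 1 / Q \<le> C exp (- 2 s T)\<close>, which forces the growth in (L). Otherwise \<open>exp (s t)\<close> up to \<open>T\<close>,
  frozen on \<open>[T, T + 1]\<close>, yields \<open>\<integral>\<^sub>T\<^sup>T\<^sup>+\<^sup>1 Q \<le> C exp (- 2 s T)\<close>, which gives the decay in (S).
\<close>

section \<open>Piecewise smooth test functions and their energy\<close>

text \<open>The function stays existentially hidden because gluing and comparison only see its end
  values and the energy \<open>e\<close>. Finitely many corners are allowed, and the bound
  \<open>B\<close> makes the function Lipschitz, so that smooth approximations have dominated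
  energies.\<close>

definition bridge ::
    "(real \<Rightarrow> real) \<Rightarrow> (real \<Rightarrow> real) \<Rightarrow> real \<Rightarrow> real \<Rightarrow> real \<Rightarrow> real \<Rightarrow> real \<Rightarrow> bool" where
  "bridge R S a x b y e \<longleftrightarrow>
     a < b \<and> (\<exists>h g K B. continuous_on {a..b} h \<and> h a = x \<and> h b = y \<and> finite K \<and>
        (\<forall>t\<in>{a<..<b} - K. (h has_real_derivative g t) (at t) \<and> \<bar>g t\<bar> \<le> B) \<and>
        ((\<lambda>t. R t * (g t)\<^sup>2 - S t * (h t)\<^sup>2) has_integral e) {a..b})"

lemma continuous_bounded_Icc:
  fixes f :: "real \<Rightarrow> real"
  assumes "continuous_on {a..b} f"
  obtains B where "\<And>t. t \<in> {a..b} \<Longrightarrow> \<bar>f t\<bar> \<le> B"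
proof -
  have "bounded (f ` {a..b})"
    by (intro compact_imp_bounded compact_continuous_image assms compact_Icc)
  then show ?thesis
    using that unfolding bounded_iff by (metis imageI real_norm_def)
qed

lemma abs_mult_power2_le:
  fixes x y :: real
  assumes "\<bar>x\<bar> \<le> C" "\<bar>y\<bar> \<le> D"
  shows "\<bar>x * y\<^sup>2\<bar> \<le> C * D\<^sup>2"
proof -
  have "\<bar>x\<bar> * \<bar>y\<bar>\<^sup>2 \<le> C * D\<^sup>2"
    using assms by (intro mult_mono power_mono) auto
  then show ?thesis
    by (simp add: abs_mult)
qed

lemma bridge_smooth:
  assumes "a < b" "continuous_on {a..b} h" "continuous_on {a..b} g"
    and "\<And>t. t \<in> {a<..<b} \<Longrightarrow> (h has_real_derivative g t) (at t)"
    and "continuous_on {a..b} R" "continuous_on {a..b} S"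
  shows "bridge R S a (h a) b (h b) (integral {a..b} (\<lambda>t. R t * (g t)\<^sup>2 - S t * (h t)\<^sup>2))"
proof -
  obtain B where B: "\<And>t. t \<in> {a..b} \<Longrightarrow> \<bar>g t\<bar> \<le> B"
    using continuous_bounded_Icc[OF assms(3)] by blast
  have "(\<lambda>t. R t * (g t)\<^sup>2 - S t * (h t)\<^sup>2) integrable_on {a..b}"
    using assms by (intro integrable_continuous_real continuous_intros)
  then show ?thesis
    unfolding bridge_def using assms B
    by (intro conjI exI[of _ h] exI[of _ g] exI[of _ "{}"] exI[of _ B] integrable_integral) auto
qed

text \<open>The two pieces agree at \<open>c\<close>, so the concatenation is continuous there;
  \<open>c\<close> joins the exceptional set because the one-sided slopes may differ.\<close>

lemma bridge_trans:
  assumes "bridge R S a x c z e1" "bridge R S c z b y e2"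
  shows "bridge R S a x b y (e1 + e2)"
proof -
  obtain h1 g1 K1 B1 where 1: "a < c" "continuous_on {a..c} h1" "h1 a = x" "h1 c = z" "finite K1"
      "\<And>t. t \<in> {a<..<c} - K1 \<Longrightarrow> (h1 has_real_derivative g1 t) (at t) \<and> \<bar>g1 t\<bar> \<le> B1"
      "((\<lambda>t. R t * (g1 t)\<^sup>2 - S t * (h1 t)\<^sup>2) has_integral e1) {a..c}"
    using assms(1) unfolding bridge_def by blast
  obtain h2 g2 K2 B2 where 2: "c < b" "continuous_on {c..b} h2" "h2 c = z" "h2 b = y" "finite K2"
      "\<And>t. t \<in> {c<..<b} - K2 \<Longrightarrow> (h2 has_real_derivative g2 t) (at t) \<and> \<bar>g2 t\<bar> \<le> B2"
      "((\<lambda>t. R t * (g2 t)\<^sup>2 - S t * (h2 t)\<^sup>2) has_integral e2) {c..b}"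
    using assms(2) unfolding bridge_def by blast
  define h where "h = (\<lambda>t. if t \<le> c then h1 t else h2 t)"
  define g where "g = (\<lambda>t. if t \<le> c then g1 t else g2 t)"
  have "continuous_on ({a..c} \<union> {c..b}) h"
    unfolding h_def
  proof (intro continuous_on_cases)
    show "\<forall>t. t \<in> {a..c} \<and> \<not> t \<le> c \<or> t \<in> {c..b} \<and> t \<le> c \<longrightarrow> h1 t = h2 t"
      using 1(4) 2(3) by (metis atLeastAtMost_iff order_antisym)
  qed (use 1 2 in auto)
  moreover have "{a..c} \<union> {c..b} = {a..b}"
    using 1(1) 2(1) by auto
  ultimately have cont: "continuous_on {a..b} h"
    by simp
  have deriv: "(h has_real_derivative g t) (at t) \<and> \<bar>g t\<bar> \<le> max B1 B2"
    if t: "t \<in> {a<..<b} - (insert c (K1 \<union> K2))" for t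
  proof (cases "t < c")
    case True
    have "(h has_real_derivative g1 t) (at t)"
      by (rule has_field_derivative_transform_within_open[of h1 _ t "{..<c}"]) (use 1(6)[of t] t True in \<open>auto simp: h_def\<close>)
    then show ?thesis
      using 1(6)[of t] t True by (auto simp: g_def)
  next
    case False
    have "(h has_real_derivative g2 t) (at t)"
      by (rule has_field_derivative_transform_within_open[of h2 _ t "{c<..}"]) (use 2(6)[of t] t False in \<open>auto simp: h_def\<close>)
    then show ?thesis
      using 2(6)[of t] t False by (auto simp: g_def)
  qed
  have "((\<lambda>t. R t * (g t)\<^sup>2 - S t * (h t)\<^sup>2) has_integral e1 + e2) {a..b}"
  proof (rule has_integral_combine)
    show "((\<lambda>t. R t * (g t)\<^sup>2 - S t * (h t)\<^sup>2) has_integral e1) {a..c}"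
      by (rule has_integral_spike_finite[OF _ _ 1(7), of "{}"]) (auto simp: g_def h_def)
    show "((\<lambda>t. R t * (g t)\<^sup>2 - S t * (h t)\<^sup>2) has_integral e2) {c..b}"
      by (rule has_integral_spike_finite[OF _ _ 2(7), of "{c}"]) (auto simp: g_def h_def)
  qed (use 1 2 in auto)
  then show ?thesis
    unfolding bridge_def using 1 2 cont deriv
    by (intro conjI exI[of _ h] exI[of _ g] exI[of _ "insert c (K1 \<union> K2)"] exI[of _ "max B1 B2"])
      (auto simp: h_def)
qed

section \<open>Nonnegative energy for test functions with corners\<close>

text \<open>The fundamental theorem with finitely many exceptional points replaces the mean value
  theorem, since no derivative is available on \<open>K\<close>.\<close>

lemma lipschitz_of_bounded_derivative:
  fixes h g :: "real \<Rightarrow> real"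
  assumes "s \<le> t" "continuous_on {s..t} h" "finite K" "0 \<le> B"
    and "\<And>r. r \<in> {s<..<t} - K \<Longrightarrow> (h has_real_derivative g r) (at r) \<and> \<bar>g r\<bar> \<le> B"
  shows "\<bar>h t - h s\<bar> \<le> B * (t - s)"
proof -
  have "(g has_integral (h t - h s)) {s..t}"
    using assms has_real_derivative_iff_has_vector_derivative
    by (intro fundamental_theorem_of_calculus_interior_strong[of K]) auto
  from has_integral_bound_real[OF assms(4) _ this, of "insert s (insert t K)"] assms
  show ?thesis by force
qed

text \<open>Steklov averages \<open>t \<mapsto> (\<integral>\<^sub>t\<^sup>t\<^sup>+\<^sup>d z) / d\<close> smooth the corners while keeping derivatives bounded.\<close>

lemma bridge_zero_nonneg:
  assumes R: "continuous_on {0<..} R" and S: "continuous_on {0<..} S"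
    and smooth: "\<And>z z' a b. 0 < a \<Longrightarrow> a < b \<Longrightarrow>
        (\<And>t. 0 < t \<Longrightarrow> (z has_real_derivative z' t) (at t)) \<Longrightarrow> continuous_on {0<..} z' \<Longrightarrow>
        (\<And>t. 0 < t \<Longrightarrow> t \<notin> {a..b} \<Longrightarrow> z t = 0) \<Longrightarrow>
        0 \<le> integral {a..b} (\<lambda>t. R t * (z' t)\<^sup>2 - S t * (z t)\<^sup>2)"
    and br: "bridge R S a 0 b 0 e" and "0 < a"
  shows "0 \<le> e"
proof -
  obtain h g K B0 where hg: "a < b" "continuous_on {a..b} h" "h a = 0" "h b = 0" "finite K"
      "\<And>t. t \<in> {a<..<b} - K \<Longrightarrow> (h has_real_derivative g t) (at t) \<and> \<bar>g t\<bar> \<le> B0"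
      "((\<lambda>t. R t * (g t)\<^sup>2 - S t * (h t)\<^sup>2) has_integral e) {a..b}"
    using br unfolding bridge_def by blast
  define B where "B = max B0 0"
  \<comment> \<open>Clamping the argument to [a, b] extends \<open>h\<close> continuously by its end
    values, which are 0.\<close>
  define z where "z t = h (max a (min b t))" for t
  \<comment> \<open>The value 0 on \<open>K\<close> and outside the interval makes the slope bounded
    by \<open>B\<close> everywhere.\<close>
  define k where "k t = (if t \<in> {a<..<b} - K then g t else 0)" for t
  define K' where "K' = insert a (insert b K)"
  have B: "0 \<le> B" "\<And>t. \<bar>k t\<bar> \<le> B"
    using hg(6) by (auto simp: B_def k_def) (metis DiffI greaterThanLessThan_iff le_max_iff_disj)
  have z0: "z t = 0" if "t \<le> a \<or> b \<le> t" for t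
    using that hg by (auto simp: z_def max_def min_def)
  have cz: "continuous_on UNIV z"
    unfolding z_def using hg(1)
    by (intro continuous_on_compose2[OF hg(2)] continuous_intros) auto
  have dz: "(z has_real_derivative k t) (at t)" if "t \<notin> K'" for t
  proof -
    consider "t < a" | "b < t" | "t \<in> {a<..<b} - K"
      using \<open>t \<notin> K'\<close> by (force simp: K'_def)
    then show ?thesis
    proof cases
      case 1
      have "(z has_real_derivative 0) (at t)"
        by (rule has_field_derivative_transform_within_open[of "\<lambda>_. 0" _ t "{..<a}"]) (use 1 z0 in auto)
      then show ?thesis using 1 by (simp add: k_def)
    next
      case 2
      have "(z has_real_derivative 0) (at t)"
        by (rule has_field_derivative_transform_within_open[of "\<lambda>_. 0" _ t "{b<..}"]) (use 2 z0 in auto)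
      then show ?thesis using 2 by (simp add: k_def)
    next
      case 3
      have "(z has_real_derivative g t) (at t)"
        by (rule has_field_derivative_transform_within_open[of h _ t "{a<..<b}"])
          (use 3 hg in \<open>auto simp: z_def\<close>)
      then show ?thesis using 3 by (auto simp: k_def)
    qed
  qed
  have fK: "finite K'" using hg by (simp add: K'_def)
  have lip: "\<bar>z t - z s\<bar> \<le> B * (t - s)" if "s \<le> t" for s t
    using that B fK dz
    by (intro lipschitz_of_bounded_derivative[of s t z K' B k] continuous_on_subset[OF cz]) auto
  \<comment> \<open>The averaging windows look forward, so they spread the support to the left only;
    \<open>\<delta> n \<le> a / 2\<close> keeps it in [a/2, b], inside the positive axis.\<close>
  define \<delta> where "\<delta> n = a / 2 / (Suc n)" for n
  have \<delta>: "0 < \<delta> n" "\<delta> n \<le> a / 2" for n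
    using \<open>0 < a\<close> by (auto simp: \<delta>_def field_simps)
  have \<delta>0: "\<delta> \<longlonglongrightarrow> 0"
    unfolding \<delta>_def by (rule LIMSEQ_Suc[OF lim_const_over_n])
  define F where "F t = integral {0..t} z" for t
  have dF: "(F has_real_derivative z t) (at t)" if "0 < t" for t
  proof -
    have "(F has_real_derivative z t) (at t within {0..t+1})"
      unfolding F_def by (rule integral_has_real_derivative) (use that continuous_on_subset[OF cz] in auto)
    then show ?thesis
      using that at_within_Icc_at[of 0 t "t+1"] by simp
  qed
  \<comment> \<open>\<open>Z n\<close> is the Steklov average. Its slope \<open>Z' n\<close> is a
    difference quotient of the Lipschitz function \<open>z\<close>, hence continuous and bounded by
    \<open>B\<close> uniformly in \<open>n\<close>.\<close>
  define Z where "Z n t = (F (t + \<delta> n) - F t) / \<delta> n" for n t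
  define Z' where "Z' n t = (z (t + \<delta> n) - z t) / \<delta> n" for n t
  have dZ: "(Z n has_real_derivative Z' n t) (at t)" if "0 < t" for n t
  proof -
    have "((\<lambda>t. F (t + \<delta> n)) has_real_derivative z (t + \<delta> n)) (at t)"
      using dF[of "t + \<delta> n"] that \<delta>(1)[of n] by (simp add: DERIV_shift[symmetric] add_pos_pos)
    then show ?thesis
      unfolding Z_def Z'_def using dF[OF that] \<delta>(1)[of n]
      by (auto intro!: derivative_eq_intros)
  qed
  \<comment> \<open>Each average is a value of \<open>z\<close> inside the window, which yields both
    the uniform closeness to \<open>z\<close> and the location of the support.\<close>
  have mvt: "\<exists>\<xi>. t < \<xi> \<and> \<xi> < t + \<delta> n \<and> Z n t = z \<xi>" if t: "0 < t" for n t
  proof -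
    obtain \<xi> where "t < \<xi>" "\<xi> < t + \<delta> n" "F (t + \<delta> n) - F t = (t + \<delta> n - t) * z \<xi>"
      using MVT2[of t "t + \<delta> n" F z] dF t \<delta>(1)[of n] by (auto intro: less_le_trans)
    then show ?thesis
      using \<delta>(1)[of n] by (intro exI[of _ \<xi>]) (simp add: Z_def)
  qed
  have Zz: "\<bar>Z n t - z t\<bar> \<le> B * \<delta> n" if t: "0 < t" for n t
  proof -
    obtain \<xi> where "t < \<xi>" "\<xi> < t + \<delta> n" "Z n t = z \<xi>"
      using mvt[OF t] by blast
    then show ?thesis
      using lip[of t \<xi>] B(1) by (smt (verit) mult_left_mono)
  qed
  have Z'B: "\<bar>Z' n t\<bar> \<le> B" for n t
    using lip[of t "t + \<delta> n"] \<delta>(1)[of n] by (auto simp: Z'_def field_simps)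
  have Z0: "Z n t = 0" if t: "0 < t" "t \<notin> {a / 2..b}" for n t
  proof -
    obtain \<xi> where "t < \<xi>" "\<xi> < t + \<delta> n" "Z n t = z \<xi>"
      using mvt[OF t(1)] by blast
    then show ?thesis
      using z0[of \<xi>] t \<delta>(2)[of n] by auto
  qed
  have cZ': "continuous_on A (Z' n)" for n A
    unfolding Z'_def using \<delta>(1)[of n]
    by (intro continuous_intros continuous_on_compose2[OF cz]) (auto simp: less_imp_neq)
  have cZ: "continuous_on {0<..} (Z n)" for n
    by (rule DERIV_continuous_on, rule has_field_derivative_at_within, rule dZ) simp
  have pos: "0 \<le> integral {a/2..b} (\<lambda>t. R t * (Z' n t)\<^sup>2 - S t * (Z n t)\<^sup>2)" for n
    by (rule smooth) (use dZ cZ' Z0 \<open>0 < a\<close> hg(1) in auto)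
  have sub: "{a/2..b} \<subseteq> {0<..}" using \<open>0 < a\<close> by auto
  have RS: "continuous_on {a/2..b} R" "continuous_on {a/2..b} S"
    using R S sub continuous_on_subset by blast+
  obtain CR where CR: "\<And>t. t \<in> {a/2..b} \<Longrightarrow> \<bar>R t\<bar> \<le> CR"
    using continuous_bounded_Icc[OF RS(1)] by blast
  obtain CS where CS: "\<And>t. t \<in> {a/2..b} \<Longrightarrow> \<bar>S t\<bar> \<le> CS"
    using continuous_bounded_Icc[OF RS(2)] by blast
  obtain Cz where Cz: "\<And>t. t \<in> {a/2..b} \<Longrightarrow> \<bar>z t\<bar> \<le> Cz"
    using continuous_bounded_Icc[OF continuous_on_subset[OF cz subset_UNIV]] by blast
  \<comment> \<open>The integrands are set to 0 on \<open>K'\<close>, where the difference quotients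
    need not converge; a finite set does not change the integrals.\<close>
  define f where "f n t = (if t \<in> K' then 0 else R t * (Z' n t)\<^sup>2 - S t * (Z n t)\<^sup>2)" for n t
  define f0 where "f0 t = (if t \<in> K' then 0 else R t * (k t)\<^sup>2 - S t * (z t)\<^sup>2)" for t
  have fi: "(f n has_integral integral {a/2..b} (\<lambda>t. R t * (Z' n t)\<^sup>2 - S t * (Z n t)\<^sup>2)) {a/2..b}" for n
  proof (rule has_integral_spike_finite[OF fK _ integrable_integral])
    show "(\<lambda>t. R t * (Z' n t)\<^sup>2 - S t * (Z n t)\<^sup>2) integrable_on {a/2..b}"
      by (intro integrable_continuous_real continuous_intros RS cZ' continuous_on_subset[OF cZ sub])
  qed (auto simp: f_def)
  have bound: "norm (f n t) \<le> CR * B\<^sup>2 + CS * (Cz + B * a)\<^sup>2" if t: "t \<in> {a/2..b}" for n t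
  proof -
    have "\<bar>Z n t\<bar> \<le> Cz + B * \<delta> n"
      using Zz[of t n] Cz[OF t] t \<open>0 < a\<close> by auto
    also have "\<dots> \<le> Cz + B * a"
      using \<delta>(2)[of n] \<open>0 < a\<close> B(1) by (auto intro!: mult_left_mono)
    finally have Zb: "\<bar>Z n t\<bar> \<le> Cz + B * a" .
    have 1: "\<bar>R t * (Z' n t)\<^sup>2\<bar> \<le> CR * B\<^sup>2"
      using abs_mult_power2_le[OF CR[OF t] Z'B] .
    have 2: "\<bar>S t * (Z n t)\<^sup>2\<bar> \<le> CS * (Cz + B * a)\<^sup>2"
      using abs_mult_power2_le[OF CS[OF t] Zb] .
    have "0 \<le> CR * B\<^sup>2" "0 \<le> CS * (Cz + B * a)\<^sup>2"
      using 1 2 by linarith+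
    then show ?thesis
      using 1 2 by (auto simp: f_def)
  qed
  have conv: "(\<lambda>n. f n t) \<longlonglongrightarrow> f0 t" if t: "t \<in> {a/2..b}" for t
  proof (cases "t \<in> K'")
    case False
    have tp: "0 < t" using t \<open>0 < a\<close> by auto
    have "filterlim \<delta> (at 0) sequentially"
      using \<delta>0 \<delta>(1) by (auto simp: filterlim_at less_imp_neq[symmetric])
    with dz[OF False] have Z'c: "(\<lambda>n. Z' n t) \<longlonglongrightarrow> k t"
      unfolding Z'_def DERIV_def by (rule filterlim_compose)
    have "(\<lambda>n. Z n t - z t) \<longlonglongrightarrow> 0"
      by (rule tendsto_rabs_zero_cancel, rule tendsto_sandwich[of "\<lambda>_. 0" _ _ "\<lambda>n. B * \<delta> n"])
        (use Zz[OF tp] \<delta>0 in \<open>auto intro!: tendsto_mult_right_zero\<close>)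
    then have "(\<lambda>n. Z n t) \<longlonglongrightarrow> z t"
      by (simp add: LIM_zero_iff)
    with Z'c False show ?thesis
      unfolding f_def f0_def by (auto intro!: tendsto_intros)
  qed (simp add: f_def f0_def)
  have lim: "(\<lambda>n. integral {a/2..b} (f n)) \<longlonglongrightarrow> integral {a/2..b} f0"
    by (rule dominated_convergence(2)[OF _ _ bound conv]) (use fi in blast, auto)
  \<comment> \<open>To the left of \<open>a\<close> the limit integrand vanishes, so only the energy
    of the bridge remains.\<close>
  have "(f0 has_integral (0 + e)) {a/2..b}"
  proof (rule has_integral_combine[of _ a])
    show "(f0 has_integral 0) {a/2..a}"
      by (rule has_integral_is_0) (auto simp: f0_def k_def z0)
    show "(f0 has_integral e) {a..b}"
      by (rule has_integral_spike_finite[OF fK _ hg(7)]) (auto simp: f0_def k_def z_def K'_def)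
  qed (use \<open>0 < a\<close> hg in auto)
  then have "integral {a/2..b} f0 = e"
    by (simp add: integral_unique)
  with lim have "(\<lambda>n. integral {a/2..b} (f n)) \<longlonglongrightarrow> e"
    by simp
  moreover have "0 \<le> integral {a/2..b} (f n)" for n
    using pos[of n] integral_unique[OF fi[of n]] by simp
  ultimately show ?thesis
    using LIMSEQ_le_const by blast
qed

section \<open>Transport of energies and the dichotomy for the weight\<close>

text \<open>Since \<open>(R y')' = (m R - S) y\<close>, a test function of the form
  \<open>y h\<close> satisfies \<open>R ((y h)')^2 - S (y h)^2 = R y^2 (h'^2 - m h^2) + (R y' y
  h^2)'\<close>. The potential \<open>S\<close> is thereby traded for the weight
  \<open>R y^2\<close> and boundary terms.\<close>

lemma bridge_mult:
  assumes R: "continuous_on {0<..} R"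
    and dy: "\<And>t. 0 < t \<Longrightarrow> (y has_real_derivative y' t) (at t)"
    and cy': "continuous_on {0<..} y'"
    and dRy': "\<And>t. 0 < t \<Longrightarrow> ((\<lambda>t. R t * y' t) has_real_derivative (m * R t - S t) * y t) (at t)"
    and "0 < a"
    and br: "bridge (\<lambda>t. R t * (y t)\<^sup>2) (\<lambda>t. m * (R t * (y t)\<^sup>2)) a x b z e"
  shows "bridge R S a (y a * x) b (y b * z)
           (e + (R b * y' b * y b * z\<^sup>2 - R a * y' a * y a * x\<^sup>2))"
proof -
  obtain h g K B where hg: "a < b" "continuous_on {a..b} h" "h a = x" "h b = z" "finite K"
      "\<And>t. t \<in> {a<..<b} - K \<Longrightarrow> (h has_real_derivative g t) (at t) \<and> \<bar>g t\<bar> \<le> B"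
      "((\<lambda>t. R t * (y t)\<^sup>2 * (g t)\<^sup>2 - m * (R t * (y t)\<^sup>2) * (h t)\<^sup>2) has_integral e) {a..b}"
    using br unfolding bridge_def by blast
  have sub: "{a..b} \<subseteq> {0<..}" using \<open>0 < a\<close> by auto
  have "continuous_on {0<..} y"
    by (rule DERIV_continuous_on, rule has_field_derivative_at_within, rule dy) simp
  then have cy: "continuous_on {a..b} y"
    using sub continuous_on_subset by blast
  have cy'2: "continuous_on {a..b} y'" and cR: "continuous_on {a..b} R"
    using cy' R sub continuous_on_subset by blast+
  obtain By where By: "\<And>t. t \<in> {a..b} \<Longrightarrow> \<bar>y t\<bar> \<le> By"
    using continuous_bounded_Icc[OF cy] by blast
  obtain By' where By': "\<And>t. t \<in> {a..b} \<Longrightarrow> \<bar>y' t\<bar> \<le> By'"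
    using continuous_bounded_Icc[OF cy'2] by blast
  obtain Bh where Bh: "\<And>t. t \<in> {a..b} \<Longrightarrow> \<bar>h t\<bar> \<le> Bh"
    using continuous_bounded_Icc[OF hg(2)] by blast
  define G where "G t = y' t * h t + y t * g t" for t
  define D where "D t = (m * R t - S t) * y t * (y t * (h t)\<^sup>2) + R t * y' t * (y' t * (h t)\<^sup>2 + y t * (2 * h t * g t))"
    for t
  \<comment> \<open>\<open>D\<close> is the derivative of the boundary term
    \<open>R y' y h^2\<close>, with \<open>(R y')'\<close> taken from the equation.\<close>
  have "(D has_integral (R b * y' b * (y b * (h b)\<^sup>2) - R a * y' a * (y a * (h a)\<^sup>2))) {a..b}"
  proof (rule fundamental_theorem_of_calculus_interior_strong[OF hg(5)])
    fix t assume t: "t \<in> {a<..<b} - K"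
    then have "0 < t" using \<open>0 < a\<close> by auto
    have "((\<lambda>t. y t * (h t)\<^sup>2) has_real_derivative y' t * (h t)\<^sup>2 + y t * (2 * h t * g t)) (at t)"
      using hg(6)[OF t] dy[OF \<open>0 < t\<close>] by (auto intro!: derivative_eq_intros)
    from DERIV_mult[OF dRy'[OF \<open>0 < t\<close>] this]
    have "((\<lambda>t. (R t * y' t) * (y t * (h t)\<^sup>2)) has_real_derivative D t) (at t)"
      by (simp add: D_def algebra_simps)
    then show "((\<lambda>t. R t * y' t * (y t * (h t)\<^sup>2)) has_vector_derivative D t) (at t)"
      by (simp add: has_real_derivative_iff_has_vector_derivative)
  qed (use hg cR cy'2 cy in \<open>auto intro!: continuous_intros\<close>)
  from has_integral_add[OF hg(7) this]
  have "((\<lambda>t. R t * (G t)\<^sup>2 - S t * (y t * h t)\<^sup>2) has_integral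
      e + (R b * y' b * (y b * (h b)\<^sup>2) - R a * y' a * (y a * (h a)\<^sup>2))) {a..b}"
    by (rule has_integral_eq[rotated]) (simp add: D_def G_def algebra_simps power2_eq_square)
  moreover have "((\<lambda>t. y t * h t) has_real_derivative G t) (at t) \<and> \<bar>G t\<bar> \<le> By' * Bh + By * B"
    if t: "t \<in> {a<..<b} - K" for t
  proof
    have "0 < t" using \<open>0 < a\<close> t by auto
    show "((\<lambda>t. y t * h t) has_real_derivative G t) (at t)"
      using hg(6)[OF t] dy[OF \<open>0 < t\<close>] by (auto intro!: derivative_eq_intros simp: G_def)
    have "\<bar>y' t * h t\<bar> \<le> By' * Bh" "\<bar>y t * g t\<bar> \<le> By * B"
      unfolding abs_mult using By[of t] By'[of t] Bh[of t] hg(6)[OF t] t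
      by (auto intro!: mult_mono)
    then show "\<bar>G t\<bar> \<le> By' * Bh + By * B"
      unfolding G_def by linarith
  qed
  ultimately show ?thesis
    unfolding bridge_def using hg cy
    by (intro conjI exI[of _ "\<lambda>t. y t * h t"] exI[of _ G] exI[of _ K] exI[of _ "By' * Bh + By * B"])
      (auto intro!: continuous_intros simp: algebra_simps)
qed

text \<open>Testing with \<open>y\<close> itself on [a, b], that is with \<open>h = 1\<close>, makes
  the boundary terms vanish at the two zeros and leaves the energy
  \<open>- m * integral {a..b} Q\<close>. As this cannot be negative, the weight vanishes on the
  interval.\<close>

lemma zero_between_zeros:
  assumes R: "continuous_on {0<..} R" "\<And>t. 0 < t \<Longrightarrow> 0 < R t" and "0 < m"
    and dy: "\<And>t. 0 < t \<Longrightarrow> (y has_real_derivative y' t) (at t)"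
    and cy': "continuous_on {0<..} y'"
    and dRy': "\<And>t. 0 < t \<Longrightarrow> ((\<lambda>t. R t * y' t) has_real_derivative (m * R t - S t) * y t) (at t)"
    and nonneg: "\<And>a b e. 0 < a \<Longrightarrow> bridge R S a 0 b 0 e \<Longrightarrow> 0 \<le> e"
    and "0 < a" "y a = 0" "y b = 0" "t \<in> {a..b}"
  shows "y t = 0"
proof (cases "a < b")
  case True
  define Q where "Q t = R t * (y t)\<^sup>2" for t
  have "continuous_on {0<..} y"
    by (rule DERIV_continuous_on, rule has_field_derivative_at_within, rule dy) simp
  then have "continuous_on {a..b} y" "continuous_on {a..b} R"
    using R \<open>0 < a\<close> by (auto intro: continuous_on_subset)
  then have cQ: "continuous_on {a..b} Q"
    unfolding Q_def by (intro continuous_intros)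
  have "bridge Q (\<lambda>t. m * Q t) a 1 b 1 (integral {a..b} (\<lambda>t. Q t * 0\<^sup>2 - m * Q t * 1\<^sup>2))"
    by (rule bridge_smooth[OF True]) (auto intro!: continuous_intros cQ)
  from bridge_mult[OF R(1) dy cy' dRy' \<open>0 < a\<close> this[unfolded Q_def]]
  have "bridge R S a 0 b 0 (- (m * integral {a..b} Q))"
    using assms(9,10) by (simp add: Q_def[abs_def])
  from nonneg[OF \<open>0 < a\<close> this] have "m * integral {a..b} Q \<le> 0"
    by simp
  then have "integral {a..b} Q \<le> 0"
    using \<open>0 < m\<close> by (simp add: mult_le_0_iff)
  moreover have Q0: "0 \<le> Q t" if "t \<in> {a..b}" for t
    using R(2)[of t] that \<open>0 < a\<close> by (simp add: Q_def)
  ultimately have "integral {a..b} Q = 0"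
    using integral_nonneg[OF integrable_continuous_real[OF cQ]] by force
  then have "Q t = 0"
    using integral_eq_0_iff[OF cQ True Q0] assms(11) by auto
  then show ?thesis
    using R(2)[of t] assms(11) \<open>0 < a\<close> by (simp add: Q_def)
next
  case False
  then have "t = a" using assms(11) by simp
  then show ?thesis using assms(9) by simp
qed

text \<open>
  A negative energy at some time is transported along the zero-energy profile \<open>exp (- s t)\<close> and then
  has to be compensated by the cheapest way of reaching \<open>0\<close>, which costs \<open>1 / \<integral> 1 / Q\<close>.
\<close>

lemma integral_inverse_le_of_negative_energy:
  assumes Q: "continuous_on {0<..} Q"
    and nonneg: "\<And>a b e. 0 < a \<Longrightarrow> bridge Q (\<lambda>t. s\<^sup>2 * Q t) a 0 b 0 e \<Longrightarrow> 0 \<le> e"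
    and "0 < a" and br: "bridge Q (\<lambda>t. s\<^sup>2 * Q t) a 0 b x e" and "e < 0"
    and pos: "\<And>t. b \<le> t \<Longrightarrow> 0 < Q t"
  shows "\<exists>C>0. \<forall>T>b. integral {T..T+1} (\<lambda>t. 1 / Q t) \<le> C * exp (- 2 * s * T)"
proof (intro exI conjI allI impI)
  \<comment> \<open>The final estimate is \<open>I (T+1) \<le> X^2 / (- e)\<close>; \<open>C\<close>
    is its right-hand side without the factor \<open>exp (- 2 * s * T)\<close>, and the summand 1
    keeps it positive when \<open>x = 0\<close>.\<close>
  define C where "C = x\<^sup>2 * exp (2 * s * b) / (- e) + 1"
  have "0 \<le> x\<^sup>2 * exp (2 * s * b) / (- e)"
    using \<open>e < 0\<close> by (intro divide_nonneg_pos mult_nonneg_nonneg) auto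
  then show "0 < C"
    by (simp add: C_def)
  fix T assume "b < T"
  have "a < b" using br by (simp add: bridge_def)
  have cQ: "continuous_on {c..d} Q" if "0 < c" for c d
    using Q that by (auto intro: continuous_on_subset)
  define X where "X = x * exp (- s * (T - b))"
  \<comment> \<open>For a multiple of \<open>exp (- s t)\<close> the squared slope is
    \<open>s^2\<close> times the square, so this piece has energy 0.\<close>
  have "bridge Q (\<lambda>t. s\<^sup>2 * Q t) b (x * exp (- s * (b - b))) T (x * exp (- s * (T - b)))
      (integral {b..T} (\<lambda>t. Q t * (- s * x * exp (- s * (t - b)))\<^sup>2
          - s\<^sup>2 * Q t * (x * exp (- s * (t - b)))\<^sup>2))"
    using \<open>0 < a\<close> \<open>a < b\<close>
    by (intro bridge_smooth[OF \<open>b < T\<close>])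
      (auto intro!: continuous_intros cQ derivative_eq_intros)
  then have br1: "bridge Q (\<lambda>t. s\<^sup>2 * Q t) b x T X 0"
    by (simp add: X_def power_mult_distrib mult_ac)
  define I where "I t = integral {T..t} (\<lambda>t. 1 / Q t)" for t
  have QT: "0 < Q t" if "t \<in> {T..T+1}" for t
    using pos[of t] that \<open>b < T\<close> by auto
  have cQT: "continuous_on {T..T+1} Q"
    using cQ \<open>b < T\<close> \<open>0 < a\<close> \<open>a < b\<close> by auto
  have "Q t \<noteq> 0" if "t \<in> {T..T+1}" for t
    using QT[OF that] by simp
  then have cinv: "continuous_on {T..T+1} (\<lambda>t. 1 / Q t)"
    by (intro continuous_on_divide continuous_on_const cQT ballI)
  have inv0: "0 \<le> 1 / Q t" if "t \<in> {T..T+1}" for t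
    using QT[OF that] by simp
  have "0 \<le> I (T+1)"
    unfolding I_def by (intro integral_nonneg integrable_continuous_real[OF cinv] inv0)
  moreover have "I (T+1) \<noteq> 0"
  proof
    assume "I (T+1) = 0"
    then have "1 / Q T = 0"
      using integral_eq_0_iff[OF cinv _ inv0] unfolding I_def by auto
    then show False using pos[of T] \<open>b < T\<close> by simp
  qed
  ultimately have Ipos: "0 < I (T+1)" by simp
  \<comment> \<open>\<open>Q h'\<close> is constant, the Euler equation for the cheapest descent
    from \<open>X\<close> to 0. Its gradient term costs \<open>X^2 / I (T+1)\<close>, and the
    potential term only lowers the energy.\<close>
  define h where "h t = X * (1 - I t / I (T+1))" for t
  define g where "g t = - X / I (T+1) * (1 / Q t)" for t
  have dI: "(I has_real_derivative 1 / Q t) (at t within {T..T+1})" if "t \<in> {T..T+1}" for t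
    unfolding I_def by (rule integral_has_real_derivative[OF cinv that])
  have cI: "continuous_on {T..T+1} I"
    using DERIV_continuous_on[OF dI] by blast
  have cg: "continuous_on {T..T+1} g"
    unfolding g_def by (intro continuous_on_mult cinv continuous_intros)
  have ch: "continuous_on {T..T+1} h"
    unfolding h_def using Ipos by (intro continuous_intros cI) auto
  have dh: "(h has_real_derivative g t) (at t)" if "t \<in> {T<..<T+1}" for t
  proof -
    have "(I has_real_derivative 1 / Q t) (at t)"
      using dI[of t] at_within_Icc_at[of T t "T+1"] that by auto
    then show ?thesis
      unfolding h_def[abs_def] g_def using Ipos
      by (auto intro!: derivative_eq_intros simp: field_simps)
  qed
  have "bridge Q (\<lambda>t. s\<^sup>2 * Q t) T (h T) (T+1) (h (T+1))
      (integral {T..T+1} (\<lambda>t. Q t * (g t)\<^sup>2 - s\<^sup>2 * Q t * (h t)\<^sup>2))"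
    by (rule bridge_smooth[OF _ ch cg dh]) (auto intro!: continuous_intros cQT)
  moreover have "h T = X" "h (T+1) = 0"
    using Ipos by (auto simp: h_def I_def)
  ultimately have br2: "bridge Q (\<lambda>t. s\<^sup>2 * Q t) T X (T+1) 0
      (integral {T..T+1} (\<lambda>t. Q t * (g t)\<^sup>2 - s\<^sup>2 * Q t * (h t)\<^sup>2))"
    by simp
  have "integral {T..T+1} (\<lambda>t. Q t * (g t)\<^sup>2 - s\<^sup>2 * Q t * (h t)\<^sup>2)
      \<le> integral {T..T+1} (\<lambda>t. (X / I (T+1))\<^sup>2 * (1 / Q t))"
  proof (rule integral_le)
    show "Q t * (g t)\<^sup>2 - s\<^sup>2 * Q t * (h t)\<^sup>2 \<le> (X / I (T+1))\<^sup>2 * (1 / Q t)" if "t \<in> {T..T+1}" for t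
    proof -
      have "0 < Q t" by (rule QT[OF that])
      then have "Q t * (g t)\<^sup>2 = (X / I (T+1))\<^sup>2 * (1 / Q t)"
        by (simp add: g_def power2_eq_square field_simps)
      then show ?thesis using \<open>0 < Q t\<close> by simp
    qed
  qed (intro integrable_continuous_real continuous_intros cQT cg ch cinv)+
  also have "\<dots> = (X / I (T+1))\<^sup>2 * I (T+1)"
    by (simp only: integral_mult_right I_def)
  also have "\<dots> = X\<^sup>2 / I (T+1)"
    using Ipos by (simp add: power2_eq_square)
  finally have "integral {T..T+1} (\<lambda>t. Q t * (g t)\<^sup>2 - s\<^sup>2 * Q t * (h t)\<^sup>2) \<le> X\<^sup>2 / I (T+1)" .
  moreover have "0 \<le> e + 0 + integral {T..T+1} (\<lambda>t. Q t * (g t)\<^sup>2 - s\<^sup>2 * Q t * (h t)\<^sup>2)"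
    by (rule nonneg[OF \<open>0 < a\<close> bridge_trans[OF bridge_trans[OF br br1] br2]])
  ultimately have "- e \<le> X\<^sup>2 / I (T+1)"
    by linarith
  then have "I (T+1) \<le> X\<^sup>2 / (- e)"
    using Ipos \<open>e < 0\<close> by (simp add: field_simps)
  also have "X\<^sup>2 / (- e) = x\<^sup>2 * exp (2 * s * b) / (- e) * exp (- 2 * s * T)"
    by (simp add: X_def power_mult_distrib algebra_simps flip: exp_add exp_double)
  also have "\<dots> \<le> C * exp (- 2 * s * T)"
    by (intro mult_right_mono) (auto simp: C_def)
  finally show "integral {T..T+1} (\<lambda>t. 1 / Q t) \<le> C * exp (- 2 * s * T)"
    by (simp add: I_def)
qed

text \<open>The competitor rises linearly on [1, 2], follows \<open>exp (s t)\<close> at zero energy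
  up to \<open>T\<close>, and stays constant on [T, T+1], where its energy is
  \<open>- s^2 exp (2 s T)\<close> times the integral of \<open>Q\<close>. The total being
  nonnegative bounds that integral.\<close>

lemma integral_le_of_nonneg_energy:
  assumes Q: "continuous_on {0<..} Q" and "s \<noteq> 0"
    and nonneg: "\<And>a b x e. 0 < a \<Longrightarrow> bridge Q (\<lambda>t. s\<^sup>2 * Q t) a 0 b x e \<Longrightarrow> 0 \<le> e"
  shows "\<exists>C. \<forall>T>2. integral {T..T+1} Q \<le> C * exp (- 2 * s * T)"
proof -
  have cQ: "continuous_on {c..d} Q" if "0 < c" for c d
    using Q that by (auto intro: continuous_on_subset)
  \<comment> \<open>The cost of the linear rise to \<open>exp (s * 2)\<close>, which does not depend
    on \<open>T\<close>.\<close>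
  define C0 where "C0 = integral {1..2} (\<lambda>t. Q t * (exp (s * 2))\<^sup>2 - s\<^sup>2 * Q t * ((t - 1) * exp (s * 2))\<^sup>2)"
  have "bridge Q (\<lambda>t. s\<^sup>2 * Q t) 1 ((1 - 1) * exp (s * 2)) 2 ((2 - 1) * exp (s * 2)) C0"
    unfolding C0_def
    by (rule bridge_smooth) (auto intro!: continuous_intros cQ derivative_eq_intros)
  then have br0: "bridge Q (\<lambda>t. s\<^sup>2 * Q t) 1 0 2 (exp (s * 2)) C0"
    by simp
  have "integral {T..T+1} Q \<le> C0 / s\<^sup>2 * exp (- 2 * s * T)" if "2 < T" for T
  proof -
    have "bridge Q (\<lambda>t. s\<^sup>2 * Q t) 2 (exp (s * 2)) T (exp (s * T))
        (integral {2..T} (\<lambda>t. Q t * (s * exp (s * t))\<^sup>2 - s\<^sup>2 * Q t * (exp (s * t))\<^sup>2))"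
      by (rule bridge_smooth[OF that]) (auto intro!: continuous_intros cQ derivative_eq_intros)
    then have br1: "bridge Q (\<lambda>t. s\<^sup>2 * Q t) 2 (exp (s * 2)) T (exp (s * T)) 0"
      by (simp add: power_mult_distrib mult_ac)
    have "bridge Q (\<lambda>t. s\<^sup>2 * Q t) T (exp (s * T)) (T+1) (exp (s * T))
        (integral {T..T+1} (\<lambda>t. Q t * 0\<^sup>2 - s\<^sup>2 * Q t * (exp (s * T))\<^sup>2))"
      by (rule bridge_smooth) (use that in \<open>auto intro!: continuous_intros cQ\<close>)
    moreover have "(exp (s * T))\<^sup>2 = exp (2 * s * T)"
      by (metis exp_double mult.assoc)
    ultimately have br2: "bridge Q (\<lambda>t. s\<^sup>2 * Q t) T (exp (s * T)) (T+1) (exp (s * T))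
        (- (s\<^sup>2 * exp (2 * s * T) * integral {T..T+1} Q))"
      by (simp add: mult_ac)
    have "0 \<le> C0 + 0 + - (s\<^sup>2 * exp (2 * s * T) * integral {T..T+1} Q)"
      by (rule nonneg[OF _ bridge_trans[OF bridge_trans[OF br0 br1] br2]]) simp
    then have "integral {T..T+1} Q \<le> C0 / (s\<^sup>2 * exp (2 * s * T))"
      using \<open>s \<noteq> 0\<close> by (simp add: field_simps)
    then show ?thesis
      by (simp add: exp_minus field_simps)
  qed
  then show ?thesis by blast
qed

section \<open>From integral bounds on the weight to increments over unit time\<close>

text \<open>The slope is \<open>V' = exp (\<kappa> t) sqrt Q\<close>, and \<open>sqrt Q\<close> is a
  convex function of \<open>1 / Q\<close>. A small integral of \<open>1 / Q\<close> thus forces a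
  large increment, as in Jensen's inequality, here in the form of a tangent line.\<close>

lemma increment_lower_bound:
  fixes V V' Q :: "real \<Rightarrow> real"
  assumes dV: "\<And>t. t \<in> {T..T+1} \<Longrightarrow> (V has_real_derivative V' t) (at t)"
    and cV': "continuous_on {T..T+1} V'"
    and pos: "\<And>t. t \<in> {T..T+1} \<Longrightarrow> 0 < V' t"
    and Q: "\<And>t. t \<in> {T..T+1} \<Longrightarrow> (V' t)\<^sup>2 = exp (2 * \<kappa> * t) * Q t"
    and "0 < C" and le: "integral {T..T+1} (\<lambda>t. 1 / Q t) \<le> C * exp (- 2 * s * T)"
  shows "exp (- \<bar>\<kappa>\<bar>) / sqrt C * exp ((\<kappa> + s) * T) \<le> V (T+1) - V T"
proof -
  \<comment> \<open>The tangent point: \<open>1 / \<epsilon>^2\<close> is exactly the bound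
    \<open>C * exp (- 2 * s * T)\<close> on the mean of \<open>1 / Q\<close> over the unit
    interval.\<close>
  define \<epsilon> where "\<epsilon> = exp (s * T) / sqrt C"
  \<comment> \<open>A lower bound for \<open>exp (\<kappa> t)\<close> on [T, T+1].\<close>
  define c where "c = exp (- \<bar>\<kappa>\<bar> + \<kappa> * T)"
  have "0 < \<epsilon>" using \<open>0 < C\<close> by (simp add: \<epsilon>_def)
  have Qpos: "0 < Q t" if "t \<in> {T..T+1}" for t
  proof -
    have "0 < (V' t)\<^sup>2" using pos[OF that] by simp
    then show ?thesis
      unfolding Q[OF that] by (simp add: zero_less_mult_iff)
  qed
  have Qeq: "Q t = exp (- 2 * \<kappa> * t) * (V' t)\<^sup>2" if "t \<in> {T..T+1}" for t
    using Q[OF that] by (simp add: exp_minus)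
  have cinv: "continuous_on {T..T+1} (\<lambda>t. 1 / Q t)"
  proof (intro continuous_intros)
    show "continuous_on {T..T+1} Q"
      by (subst continuous_on_cong[OF refl Qeq]) (auto intro!: continuous_intros cV')
    show "\<forall>t\<in>{T..T+1}. Q t \<noteq> 0"
      using Qpos by force
  qed
  have pt: "c * (3 * \<epsilon> / 2 - \<epsilon> ^ 3 / 2 * (1 / Q t)) \<le> V' t" if t: "t \<in> {T..T+1}" for t
  proof -
    define X where "X = sqrt (Q t)"
    have "0 < X" and X2: "X\<^sup>2 = Q t"
      using Qpos[OF t] by (auto simp: X_def)
    \<comment> \<open>This factorisation is the tangent inequality for
      \<open>p powr (- 1 / 2)\<close> at \<open>1 / \<epsilon>^2\<close>, evaluated at
      \<open>p = 1 / X^2\<close>.\<close>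
    have "0 \<le> (X - \<epsilon>)\<^sup>2 * (2 * X + \<epsilon>)"
      using \<open>0 < X\<close> \<open>0 < \<epsilon>\<close> by simp
    also have "\<dots> = 2 * X ^ 3 - 3 * \<epsilon> * X\<^sup>2 + \<epsilon> ^ 3"
      by (simp add: algebra_simps power2_eq_square power3_eq_cube)
    finally have "3 * \<epsilon> / 2 - \<epsilon> ^ 3 / 2 * (1 / X\<^sup>2) \<le> X"
      using \<open>0 < X\<close> by (simp add: field_simps power2_eq_square power3_eq_cube)
    then have "c * (3 * \<epsilon> / 2 - \<epsilon> ^ 3 / 2 * (1 / Q t)) \<le> c * X"
      unfolding X2 by (intro mult_left_mono) (auto simp: c_def)
    also have "c \<le> exp (\<kappa> * t)"
    proof -
      have "- \<bar>\<kappa>\<bar> \<le> \<kappa> * (t - T)"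
      proof -
        have "\<bar>\<kappa> * (t - T)\<bar> \<le> \<bar>\<kappa>\<bar> * 1"
          unfolding abs_mult using t by (intro mult_left_mono) auto
        then show ?thesis by linarith
      qed
      then show ?thesis by (simp add: c_def algebra_simps)
    qed
    then have "c * X \<le> exp (\<kappa> * t) * X"
      using \<open>0 < X\<close> by simp
    also have "exp (\<kappa> * t) * X = V' t"
    proof (rule power2_eq_imp_eq)
      show "(exp (\<kappa> * t) * X)\<^sup>2 = (V' t)\<^sup>2"
        by (simp add: power_mult_distrib X2 Q[OF t] mult_ac flip: exp_double)
    qed (use \<open>0 < X\<close> pos[OF t] in auto)
    finally show ?thesis .
  qed
  have "(V' has_integral (V (T+1) - V T)) {T..T+1}"
    using dV by (intro fundamental_theorem_of_calculus)
      (auto simp: has_real_derivative_iff_has_vector_derivative[symmetric] intro: has_field_derivative_at_within)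
  then have V: "integral {T..T+1} V' = V (T+1) - V T"
    by (rule integral_unique)
  have "exp (- \<bar>\<kappa>\<bar>) / sqrt C * exp ((\<kappa> + s) * T) = c * \<epsilon>"
    by (simp add: c_def \<epsilon>_def algebra_simps flip: exp_add)
  also have "\<dots> = c * (3 * \<epsilon> / 2 - \<epsilon> ^ 3 / 2 * (C * exp (- 2 * s * T)))"
  proof -
    have "\<epsilon>\<^sup>2 * (C * exp (- 2 * s * T)) = 1"
      using \<open>0 < C\<close> by (simp add: \<epsilon>_def power_divide exp_minus field_simps flip: exp_double)
    then have "\<epsilon> ^ 3 * (C * exp (- 2 * s * T)) = \<epsilon>"
      by (metis (no_types, opaque_lifting) mult.assoc mult.comm_neutral power3_eq_cube power2_eq_square)
    then show ?thesis by simp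
  qed
  also have "\<dots> \<le> c * (3 * \<epsilon> / 2 - \<epsilon> ^ 3 / 2 * integral {T..T+1} (\<lambda>t. 1 / Q t))"
    using le \<open>0 < \<epsilon>\<close> by (intro mult_left_mono diff_left_mono) (auto simp: c_def)
  also have "\<dots> = integral {T..T+1} (\<lambda>t. c * (3 * \<epsilon> / 2 - \<epsilon> ^ 3 / 2 * (1 / Q t)))"
  proof -
    have I: "((\<lambda>t. c * (3 * \<epsilon> / 2 - \<epsilon> ^ 3 / 2 * (1 / Q t))) has_integral
       c * ((T + 1 - T) *\<^sub>R (3 * \<epsilon> / 2) - \<epsilon> ^ 3 / 2 * integral {T..T+1} (\<lambda>t. 1 / Q t))) {T..T+1}"
      by (intro has_integral_mult_right has_integral_diff integrable_integral
          integrable_continuous_real[OF cinv])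
        (metis add_increasing2 content_real has_integral_const_real order_refl zero_le_one)
    show ?thesis
      unfolding integral_unique[OF I] by simp
  qed
  also have "\<dots> \<le> integral {T..T+1} V'"
    by (intro integral_le pt integrable_continuous_real continuous_on_mult continuous_on_diff
        continuous_on_const cinv cV')
  finally show ?thesis
    by (simp add: V)
qed

text \<open>Here \<open>\<bar>W'\<bar> = exp (\<kappa> t) sqrt Q\<close> is linearised by Young's
  inequality. The weight \<open>exp (s * T)\<close> balances it: the integral of
  \<open>exp (s T) Q\<close> and the constant \<open>exp (- s T)\<close> are of the same
  order.\<close>

lemma increment_upper_bound:
  fixes W W' Q :: "real \<Rightarrow> real"
  assumes dW: "\<And>t. t \<in> {T..T+1} \<Longrightarrow> (W has_real_derivative W' t) (at t)"
    and cW': "continuous_on {T..T+1} W'"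
    and Q: "\<And>t. t \<in> {T..T+1} \<Longrightarrow> (W' t)\<^sup>2 = exp (2 * \<kappa> * t) * Q t"
    and le: "integral {T..T+1} Q \<le> C * exp (- 2 * s * T)"
    and t: "t \<in> {T..T+1}"
  shows "\<bar>W t - W T\<bar> \<le> exp \<bar>\<kappa>\<bar> * ((C + 1) / 2) * exp ((\<kappa> - s) * T)"
proof -
  \<comment> \<open>An upper bound for \<open>exp (\<kappa> r)\<close> on [T, T+1].\<close>
  define c where "c = exp (\<bar>\<kappa>\<bar> + \<kappa> * T)"
  define F where "F r = c * ((exp (s * T) * Q r + exp (- s * T)) / 2)" for r
  have Qeq: "Q r = exp (- 2 * \<kappa> * r) * (W' r)\<^sup>2" if "r \<in> {T..T+1}" for r
    using Q[OF that] by (simp add: exp_minus)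
  have cQ: "continuous_on {T..T+1} Q"
    by (subst continuous_on_cong[OF refl Qeq]) (auto intro!: continuous_intros cW')
  have pt: "\<bar>W' r\<bar> \<le> F r" if r: "r \<in> {T..T+1}" for r
  proof -
    define X where "X = sqrt (Q r)"
    have "0 \<le> Q r" using Qeq[OF r] by simp
    then have "0 \<le> X" and X2: "X\<^sup>2 = Q r"
      by (auto simp: X_def)
    have "0 \<le> exp (s * T) * (X - exp (- s * T))\<^sup>2"
      by simp
    also have "\<dots> = exp (s * T) * X\<^sup>2 + exp (- s * T) - 2 * X"
      by (simp add: power2_eq_square algebra_simps exp_minus)
    finally have X: "X \<le> (exp (s * T) * Q r + exp (- s * T)) / 2"
      by (simp add: X2)
    have "\<bar>W' r\<bar> = exp (\<kappa> * r) * X"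
    proof (rule power2_eq_imp_eq)
      show "\<bar>W' r\<bar>\<^sup>2 = (exp (\<kappa> * r) * X)\<^sup>2"
        by (simp add: power_mult_distrib X2 Q[OF r] mult_ac flip: exp_double)
    qed (use \<open>0 \<le> X\<close> in auto)
    also have "\<dots> \<le> c * X"
    proof (intro mult_right_mono \<open>0 \<le> X\<close>)
      have "\<bar>\<kappa> * (r - T)\<bar> \<le> \<bar>\<kappa>\<bar> * 1"
        unfolding abs_mult using r by (intro mult_left_mono) auto
      then have "\<kappa> * (r - T) \<le> \<bar>\<kappa>\<bar>" by linarith
      then show "exp (\<kappa> * r) \<le> c"
        by (simp add: c_def algebra_simps)
    qed
    also have "\<dots> \<le> F r"
      using X unfolding F_def by (intro mult_left_mono) (auto simp: c_def)
    finally show ?thesis .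
  qed
  have "(W' has_integral (W t - W T)) {T..t}"
    using dW t by (intro fundamental_theorem_of_calculus)
      (auto simp: has_real_derivative_iff_has_vector_derivative[symmetric] intro: has_field_derivative_at_within)
  then have W: "integral {T..t} W' = W t - W T"
    by (rule integral_unique)
  have cont: "continuous_on {T..T+1} F"
    unfolding F_def by (intro continuous_intros cQ) auto
  have int: "F integrable_on {T..r}" if "r \<le> T + 1" for r
    by (rule integrable_continuous_real, rule continuous_on_subset[OF cont]) (use that in auto)
  have "norm (integral {T..t} W') \<le> integral {T..t} F"
    by (rule integral_norm_bound_integral)
      (use t pt int in \<open>auto intro!: integrable_continuous_real intro: continuous_on_subset[OF cW']\<close>)
  also have "\<dots> \<le> integral {T..T+1} F"
    using t int by (intro integral_subset_le ballI order_trans[OF abs_ge_zero pt]) auto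
  also have "\<dots> = c * ((exp (s * T) * integral {T..T+1} Q + exp (- s * T)) / 2)"
  proof -
    have I: "(F has_integral
       c * ((exp (s * T) * integral {T..T+1} Q + (T + 1 - T) *\<^sub>R exp (- s * T)) / 2)) {T..T+1}"
      unfolding F_def by (intro has_integral_mult_right has_integral_divide has_integral_add integrable_integral
          integrable_continuous_real[OF cQ])
        (metis add_increasing2 content_real has_integral_const_real order_refl zero_le_one)
    show ?thesis
      unfolding integral_unique[OF I] by simp
  qed
  also have "\<dots> \<le> c * ((exp (s * T) * (C * exp (- 2 * s * T)) + exp (- s * T)) / 2)"
    using le by (intro mult_left_mono divide_right_mono add_right_mono) (auto simp: c_def)
  also have "exp (s * T) * (C * exp (- 2 * s * T)) = C * exp (- s * T)"
    by (simp add: algebra_simps flip: exp_add)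
  also have "c * ((C * exp (- s * T) + exp (- s * T)) / 2) = exp \<bar>\<kappa>\<bar> * ((C + 1) / 2) * exp ((\<kappa> - s) * T)"
    by (simp add: c_def algebra_simps exp_add exp_diff exp_minus divide_simps)
  finally show ?thesis
    by (simp add: W)
qed

section \<open>Radial solutions on the exterior domain\<close>

text \<open>The minus sign turns the half-lines \<open>{x<..}\<close> into balls of radius
  \<open>exp (- x)\<close>, which have finite measure, so comparing the two measures on such
  half-lines determines them. For \<open>ln (norm x)\<close> the same sets would have infinite
  measure.\<close>

lemma distr_neg_ln_norm:
  "distr lborel borel (\<lambda>x::'a::euclidean_space. - ln (norm x)) =
     density lborel (\<lambda>t. ennreal (DIM('a) * unit_ball_vol DIM('a) * exp (- (DIM('a) * t))))"
  (is "?M = ?D")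
proof (rule measure_eqI_lessThan)
  define N where "N = real DIM('a)"
  define c where "c = N * unit_ball_vol N"
  have N: "0 < N" by (simp add: N_def)
  have c: "0 \<le> c" by (simp add: c_def N_def)
  have M: "emeasure ?M {x<..} = ennreal (unit_ball_vol N * exp (- (N * x)))" for x
  proof -
    define A where "A = (\<lambda>x::'a. - ln (norm x)) -` {x<..}"
    have mA: "A \<in> sets lborel"
      unfolding A_def by (simp add: measurable_sets_borel[where M = borel])
    have "emeasure ?M {x<..} = emeasure lborel A"
      by (simp add: emeasure_distr A_def)
    \<comment> \<open>Because \<open>ln 0 = 0\<close>, the origin belongs to \<open>A\<close> for
      some \<open>x\<close> only; adding this null point always gives a full ball.\<close>
    also have "\<dots> = emeasure lborel (A \<union> {0})"
      using mA by (intro emeasure_Un_null_set[symmetric]) auto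
    also have "A \<union> {0} = ball 0 (exp (- x))"
    proof (intro set_eqI)
      fix z :: 'a
      show "z \<in> A \<union> {0} \<longleftrightarrow> z \<in> ball 0 (exp (- x))"
      proof (cases "z = 0")
        case False
        then have "x < - ln (norm z) \<longleftrightarrow> norm z < exp (- x)"
          using ln_less_cancel_iff[of "norm z" "exp (- x)"] by auto
        with False show ?thesis by (simp add: A_def)
      qed simp
    qed
    also have "emeasure lborel \<dots> = ennreal (unit_ball_vol N * exp (- x) ^ DIM('a))"
      by (simp add: emeasure_ball N_def)
    also have "exp (- x) ^ DIM('a) = exp (- (N * x))"
      by (simp add: N_def flip: exp_of_nat_mult)
    finally show ?thesis .
  qed
  show "emeasure ?M {x<..} < \<infinity>" for x
    by (simp add: M)
  show "emeasure ?M {x<..} = emeasure ?D {x<..}" for x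
  proof -
    have "emeasure ?D {x<..} = (\<integral>\<^sup>+t. ennreal (c * exp (- (N * t))) * indicator {x<..} t \<partial>lborel)"
      by (simp add: emeasure_density c_def N_def)
    also have "\<dots> = (\<integral>\<^sup>+t. ennreal (c * exp (- (N * t))) * indicator {x..} t \<partial>lborel)"
      using AE_lborel_singleton[of x] by (intro nn_integral_cong_AE) (auto split: split_indicator)
    also have "\<dots> = ennreal (0 - (- (c / N * exp (- (N * x)))))"
    proof (rule nn_integral_FTC_atLeast)
      show "((\<lambda>t. - (c / N * exp (- (N * t)))) has_real_derivative c * exp (- (N * t))) (at t)" for t
        using N by (auto intro!: derivative_eq_intros)
      have "((\<lambda>t. - (c / N * exp (- (N * t)))) \<longlongrightarrow> - (c / N * 0)) at_top"
        using N
        by (intro tendsto_intros filterlim_compose[OF exp_at_bot]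
            filterlim_compose[OF filterlim_uminus_at_bot_at_top]
            filterlim_tendsto_pos_mult_at_top[OF tendsto_const] filterlim_ident)
      then show "((\<lambda>t. - (c / N * exp (- (N * t)))) \<longlongrightarrow> 0) at_top"
        by simp
    qed (use c in auto)
    also have "\<dots> = emeasure ?M {x<..}"
      using N by (simp add: M c_def)
    finally show ?thesis by simp
  qed
qed auto

text \<open>Polar coordinates with \<open>r = exp t\<close>, obtained from the law of
  \<open>- ln (norm x)\<close> by the reflection of the line.\<close>

lemma lborel_integral_ln_norm:
  fixes F :: "real \<Rightarrow> real"
  assumes [measurable]: "F \<in> borel_measurable borel"
  shows "(\<integral>x. F (ln (norm (x::'a::euclidean_space))) \<partial>lborel) =
    DIM('a) * unit_ball_vol DIM('a) * (\<integral>t. exp (DIM('a) * t) * F t \<partial>lborel)"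
proof -
  define c where "c = DIM('a) * unit_ball_vol DIM('a)"
  have c: "0 \<le> c" by (simp add: c_def)
  have "(\<integral>x. F (ln (norm (x::'a))) \<partial>lborel) = (\<integral>x. F (- (- ln (norm (x::'a)))) \<partial>lborel)"
    by simp
  also have "\<dots> = (\<integral>t. F (- t) \<partial>(distr lborel borel (\<lambda>x::'a. - ln (norm x))))"
    by (rule integral_distr[symmetric]) auto
  also have "\<dots> = (\<integral>t. F (- t) \<partial>(density lborel (\<lambda>t. ennreal (c * exp (- (DIM('a) * t))))))"
    by (simp add: distr_neg_ln_norm c_def)
  also have "\<dots> = (\<integral>t. (c * exp (- (DIM('a) * t))) *\<^sub>R F (- t) \<partial>lborel)"
    using c by (intro integral_density) auto
  also have "\<dots> = (\<integral>t. c * (exp (DIM('a) * t) * F t) \<partial>lborel)"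
    by (subst (2) lborel_integral_real_affine[of "-1" _ 0]) (auto simp: mult_ac)
  also have "\<dots> = c * (\<integral>t. exp (DIM('a) * t) * F t \<partial>lborel)"
    by simp
  finally show ?thesis by (simp add: c_def)
qed

section \<open>The radial equation and radial test functions\<close>

lemma grad_on_eqI:
  assumes "(g has_derivative g') (at x)" "x \<in> interior S"
  shows "grad_on S g x $ i = g' (axis i 1)"
  unfolding grad_on_def at_within_interior[OF assms(2)] frechet_derivative_at[OF assms(1), symmetric]
  by simp

lemma grad_on_radial:
  fixes u :: "real ^ 'n \<Rightarrow> real"
  assumes "(\<phi> has_real_derivative \<phi>') (at (norm x))" "x \<noteq> 0" "x \<in> interior S"
    and "open U" "x \<in> U" "\<And>y. y \<in> U \<Longrightarrow> u y = \<phi> (norm y)"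
  shows "u differentiable (at x)" "grad_on S u x = (\<phi>' / norm x) *\<^sub>R x"
proof -
  have "((\<lambda>y. \<phi> (norm y)) has_derivative (\<lambda>h. \<phi>' * (h \<bullet> sgn x))) (at x)"
    using has_derivative_compose[OF has_derivative_norm[OF assms(2)], of \<phi> "(*) \<phi>'"] assms(1)
    by (simp add: has_field_derivative_def)
  then have u': "(u has_derivative (\<lambda>h. \<phi>' * (h \<bullet> sgn x))) (at x)"
    by (rule has_derivative_transform_within_open[OF _ assms(4,5)]) (simp add: assms(6))
  then show "u differentiable (at x)"
    by (auto simp: differentiable_def)
  show "grad_on S u x = (\<phi>' / norm x) *\<^sub>R x"
    by (simp add: vec_eq_iff grad_on_eqI[OF u' assms(3)] inner_axis inner_axis' sgn_div_norm field_simps)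
qed

lemma interior_exterior_ball:
  fixes x :: "'a::real_normed_vector"
  assumes "1 < norm x"
  shows "x \<in> interior (- ball 0 1)" "x \<in> interior (- cball 0 1)"
proof -
  have "x \<in> - cball 0 1" "open (- cball (0::'a) 1)" "- cball (0::'a) 1 \<subseteq> - ball 0 1"
    using assms by auto
  then show "x \<in> interior (- ball 0 1)" "x \<in> interior (- cball 0 1)"
    by (auto intro: interiorI)
qed

lemma has_real_derivative_along_axis:
  fixes g :: "real ^ 'n \<Rightarrow> real"
  assumes "g differentiable_on (- ball 0 1)" "1 < r"
  shows "((\<lambda>r. g (r *\<^sub>R axis k 1)) has_real_derivative
           grad_on (- ball 0 1) g (r *\<^sub>R axis k 1) $ k) (at r)"
proof -
  let ?S = "- ball (0::real ^ 'n) 1" and ?x = "r *\<^sub>R axis k (1::real) :: real ^ 'n"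
  have "1 < norm ?x" using assms(2) by (simp add: norm_axis_1)
  note int = interior_exterior_ball(1)[OF this]
  have "g differentiable (at ?x)"
    using assms(1) int interior_subset unfolding differentiable_on_def
    by (metis at_within_interior subsetD)
  then obtain g' where g': "(g has_derivative g') (at ?x)"
    by (auto simp: differentiable_def)
  have "((\<lambda>r. g (r *\<^sub>R axis k 1)) has_derivative (\<lambda>h. g' (h *\<^sub>R axis k 1))) (at r)"
    using has_derivative_compose[of "\<lambda>r. r *\<^sub>R axis k 1" "\<lambda>h. h *\<^sub>R axis k 1" r UNIV g g'] g'
    by (simp add: has_derivative_scaleR_left)
  moreover have "(\<lambda>h. g' (h *\<^sub>R axis k 1)) = (*) (grad_on ?S g ?x $ k)"
    using linear_scale[OF has_derivative_linear[OF g']] by (auto simp: grad_on_eqI[OF g' int])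
  ultimately show ?thesis
    by (simp add: has_field_derivative_def)
qed

text \<open>On the ray through a unit axis vector \<open>e\<close>, the second derivative of
  \<open>u\<close> in direction \<open>e\<close> is that of the profile, and each of the remaining
  diagonal entries of the Hessian equals \<open>p r / r\<close>. Their sum is the Laplacian.\<close>

lemma radial_ode:
  fixes f w :: "real \<Rightarrow> real" and u :: "real ^ 'n \<Rightarrow> real"
  assumes radial: "\<And>x. x \<in> - ball 0 1 \<Longrightarrow> u x = w (norm x)"
    and sol: "classical_solution_on (- ball 0 1) f u"
  obtains p q where "continuous_on {1..} w"
    and "\<And>r. 1 < r \<Longrightarrow> (w has_real_derivative p r) (at r)"
    and "\<And>r. 1 < r \<Longrightarrow> (p has_real_derivative q r) (at r)"
    and "\<And>r. 1 < r \<Longrightarrow> q r + (real CARD('n) - 1) * (p r / r) = - f (w r)"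
proof -
  let ?S = "- ball (0::real ^ 'n) 1"
  define k where "k = (undefined :: 'n)"
  define e where "e = (axis k 1 :: real ^ 'n)"
  have ne: "norm e = 1" by (simp add: e_def norm_axis_1)
  then have "e \<noteq> 0" by auto
  have du: "u differentiable_on ?S"
    and dg: "\<And>i. (\<lambda>x. grad_on ?S u x $ i) differentiable_on ?S"
    and lap: "\<And>x. x \<in> ?S \<Longrightarrow> - laplacian_on ?S u x = f (u x)"
    using sol by (auto simp: classical_solution_on_def C2_on_def C1_on_def)
  have wu: "u (r *\<^sub>R e) = w r" if "1 \<le> r" for r
    using radial[of "r *\<^sub>R e"] that by (simp add: ne)
  define p where "p r = grad_on ?S u (r *\<^sub>R e) $ k" for r
  define q where "q r = grad_on ?S (\<lambda>x. grad_on ?S u x $ k) (r *\<^sub>R e) $ k" for r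
  have "continuous_on {1..} (\<lambda>r. u (r *\<^sub>R e))"
    by (rule continuous_on_compose2[OF differentiable_imp_continuous_on[OF du]])
      (auto intro!: continuous_intros simp: ne)
  then have cw: "continuous_on {1..} w"
    by (rule continuous_on_eq) (simp add: wu)
  have dw: "(w has_real_derivative p r) (at r)" if "1 < r" for r
  proof -
    have "((\<lambda>r. u (r *\<^sub>R e)) has_real_derivative p r) (at r)"
      using has_real_derivative_along_axis[OF du that, of k] by (simp add: p_def e_def)
    then show ?thesis
      by (rule has_field_derivative_transform_within_open[of _ _ _ "{1<..}"]) (use that wu in auto)
  qed
  have dp: "(p has_real_derivative q r) (at r)" if "1 < r" for r
    using has_real_derivative_along_axis[OF dg that, of k k] by (simp add: p_def[abs_def] q_def e_def)
  have U: "open (- cball (0::real ^ 'n) 1)" by auto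
  have grad: "grad_on ?S u x = (p (norm x) / norm x) *\<^sub>R x" if "1 < norm x" for x
    by (rule grad_on_radial(2)[OF dw _ interior_exterior_ball(1) U]) (use that radial in auto)
  have off: "grad_on ?S (\<lambda>x. grad_on ?S u x $ i) (r *\<^sub>R e) $ i = p r / r" if "1 < r" "i \<noteq> k" for r i
  proof -
    have nx: "1 < norm (r *\<^sub>R e)" using that by (simp add: ne)
    have "((\<lambda>s. p s / s) has_real_derivative (q r * r - p r) / (r * r)) (at r)"
      using dp[OF that(1)] that(1) by (auto intro!: derivative_eq_intros)
    then have "(\<lambda>x. p (norm x) / norm x) differentiable (at (r *\<^sub>R e))"
      by (intro grad_on_radial(1)[OF _ _ interior_exterior_ball(1)[OF nx] open_UNIV])
        (use that nx \<open>e \<noteq> 0\<close> in \<open>auto simp: ne\<close>)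
    \<comment> \<open>Only the existence of \<open>L\<close> matters: in the product rule its term
      carries the factor \<open>(r *\<^sub>R e) $ i\<close>, which is 0 for
      \<open>i \<noteq> k\<close>.\<close>
    then obtain L where L: "((\<lambda>x. p (norm x) / norm x) has_derivative L) (at (r *\<^sub>R e))"
      by (auto simp: differentiable_def)
    have "((\<lambda>x. p (norm x) / norm x * x $ i) has_derivative
        (\<lambda>h. p (norm (r *\<^sub>R e)) / norm (r *\<^sub>R e) * h $ i + L h * (r *\<^sub>R e) $ i)) (at (r *\<^sub>R e))"
      by (rule has_derivative_mult[OF L])
        (rule bounded_linear.has_derivative[OF bounded_linear_vec_nth has_derivative_ident])
    then have "((\<lambda>x. grad_on ?S u x $ i) has_derivative
        (\<lambda>h. p (norm (r *\<^sub>R e)) / norm (r *\<^sub>R e) * h $ i + L h * (r *\<^sub>R e) $ i)) (at (r *\<^sub>R e))"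
      by (rule has_derivative_transform_within_open[OF _ U]) (use nx grad in auto)
    from grad_on_eqI[OF this interior_exterior_ball(1)[OF nx], of i]
    have "grad_on ?S (\<lambda>x. grad_on ?S u x $ i) (r *\<^sub>R e) $ i
        = p (norm (r *\<^sub>R e)) / norm (r *\<^sub>R e) + L (axis i 1) * (r *\<^sub>R e) $ i"
      by (simp add: axis_def)
    moreover have "e $ i = 0"
      using that by (simp add: e_def axis_def)
    ultimately show ?thesis
      using that by (simp add: ne)
  qed
  have ode: "q r + (real CARD('n) - 1) * (p r / r) = - f (w r)" if "1 < r" for r
  proof -
    have "laplacian_on ?S u (r *\<^sub>R e) =
        q r + (\<Sum>i\<in>UNIV - {k}. grad_on ?S (\<lambda>x. grad_on ?S u x $ i) (r *\<^sub>R e) $ i)"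
      unfolding laplacian_on_def q_def by (rule sum.remove) auto
    also have "(\<Sum>i\<in>UNIV - {k}. grad_on ?S (\<lambda>x. grad_on ?S u x $ i) (r *\<^sub>R e) $ i)
        = (\<Sum>i\<in>UNIV - {k}. p r / r)"
      using off[OF that] by (intro sum.cong) auto
    also have "\<dots> = (real CARD('n) - 1) * (p r / r)"
      by (simp add: card_Diff_singleton of_nat_diff Suc_leI)
    finally show ?thesis
      using lap[of "r *\<^sub>R e"] wu[of r] that by (simp add: ne)
  qed
  from that[OF cw dw dp ode] show thesis by blast
qed

text \<open>The test function \<open>z (ln (norm x))\<close> has squared gradient
  \<open>(z' t)^2 exp (- 2 t)\<close>, and the volume element is a positive multiple of
  \<open>exp (N t) dt\<close>; this explains the two exponential weights.\<close>

lemma radial_stability: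
  fixes f w :: "real \<Rightarrow> real" and u :: "real ^ 'n \<Rightarrow> real"
  assumes radial: "\<And>x. x \<in> - ball 0 1 \<Longrightarrow> u x = w (norm x)"
    and stable: "stable_on (- cball 0 1) f u"
    and cw: "continuous_on {1..} w" and cf': "continuous_on UNIV (deriv f)"
    and "0 < a"
    and dz: "\<And>t. 0 < t \<Longrightarrow> (z has_real_derivative z' t) (at t)"
    and cz': "continuous_on {0<..} z'"
    and z0: "\<And>t. 0 < t \<Longrightarrow> t \<notin> {a..b} \<Longrightarrow> z t = 0"
  shows "0 \<le> integral {a..b} (\<lambda>t. exp ((real CARD('n) - 2) * t) * (z' t)\<^sup>2
            - exp (CARD('n) * t) * deriv f (w (exp t)) * (z t)\<^sup>2)"
proof -
  let ?\<Omega> = "- cball (0::real ^ 'n) 1"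
  define v where "v x = z (ln (norm x))" for x :: "real ^ 'n"
  have z'0: "z' t = 0" if "0 < t" "t \<notin> {a..b}" for t
  proof -
    have "((\<lambda>_. 0) has_real_derivative z' t) (at t)"
      by (rule has_field_derivative_transform_within_open[OF dz[OF that(1)], of "{0<..} - {a..b}"])
        (use that z0 in \<open>auto intro!: open_Diff\<close>)
    then show ?thesis
      using DERIV_unique[OF _ DERIV_const] by blast
  qed
  have dv: "((\<lambda>r. z (ln r)) has_real_derivative z' (ln r) / r) (at r)" if "1 < r" for r
    using DERIV_chain2[OF dz[of "ln r"] DERIV_ln_divide[of r]] that by simp
  have gradv: "v differentiable (at x)" "grad_on ?\<Omega> v x = (z' (ln (norm x)) / norm x / norm x) *\<^sub>R x"
    if "x \<in> ?\<Omega>" for x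
  proof -
    have "1 < norm x" "x \<noteq> 0" using that by auto
    note grad_on_radial[OF dv[OF this(1)] this(2) interior_exterior_ball(2)[OF this(1)] open_UNIV, of v]
    from this[OF UNIV_I]
    show "v differentiable (at x)" "grad_on ?\<Omega> v x = (z' (ln (norm x)) / norm x / norm x) *\<^sub>R x"
      unfolding v_def[abs_def] by auto
  qed
  have "continuous_on ?\<Omega> (\<lambda>x. (z' (ln (norm x)) / norm x / norm x) *\<^sub>R x)"
    by (intro continuous_intros continuous_on_compose2[OF cz'])
      (auto intro!: ln_gt_zero)
  then have "continuous_on ?\<Omega> (grad_on ?\<Omega> v)"
    by (rule continuous_on_eq) (simp add: gradv(2))
  then have "C1_on ?\<Omega> v"
    using gradv(1) by (auto simp: C1_on_def differentiable_on_def intro: differentiable_at_withinI)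
  moreover
  \<comment> \<open>A closed annulus containing the support; it lies in the open exterior domain
    because \<open>0 < a\<close>.\<close>
  define A where "A = cball (0::real ^ 'n) (exp b) - ball 0 (exp a)"
  have "x \<in> A" if "x \<in> ?\<Omega>" "v x \<noteq> 0" for x
  proof -
    have "1 < norm x" using that by simp
    then have "ln (norm x) \<in> {a..b}"
      using z0[of "ln (norm x)"] that ln_gt_zero[of "norm x"] by (auto simp: v_def)
    then have "exp a \<le> exp (ln (norm x))" "exp (ln (norm x)) \<le> exp b"
      by (auto simp only: exp_le_cancel_iff atLeastAtMost_iff)
    moreover have "exp (ln (norm x)) = norm x"
      using \<open>1 < norm x\<close> by (intro exp_ln) auto
    ultimately have "exp a \<le> norm x" "norm x \<le> exp b"
      by (simp_all only:)
    then show ?thesis by (auto simp: A_def)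
  qed
  moreover have "compact A"
    by (auto simp: A_def intro!: compact_diff)
  ultimately have "test_function_on ?\<Omega> v"
  proof -
    assume 1: "C1_on ?\<Omega> v" "\<And>x. x \<in> ?\<Omega> \<Longrightarrow> v x \<noteq> 0 \<Longrightarrow> x \<in> A" "compact A"
    have cl: "closure {x \<in> ?\<Omega>. v x \<noteq> 0} \<subseteq> A"
      using 1 by (intro closure_minimal compact_imp_closed) auto
    have "1 < exp a" using \<open>0 < a\<close> by simp
    have "A \<subseteq> ?\<Omega>"
    proof
      fix x assume "x \<in> A"
      then have "exp a \<le> norm x"
        by (simp add: A_def)
      with \<open>1 < exp a\<close> have "1 < norm x"
        by (rule less_le_trans)
      then show "x \<in> ?\<Omega>"
        by simp
    qed
    have "bounded {x \<in> ?\<Omega>. v x \<noteq> 0}"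
      using 1(2) by (intro bounded_subset[OF compact_imp_bounded[OF 1(3)]]) blast
    then have "compact (closure {x \<in> ?\<Omega>. v x \<noteq> 0})"
      by (simp only: compact_closure)
    with 1(1) cl \<open>A \<subseteq> ?\<Omega>\<close> show ?thesis
      unfolding test_function_on_def by blast
  qed
  then have "0 \<le> (LINT x:?\<Omega>|lborel. (norm (grad_on ?\<Omega> v x))\<^sup>2 - deriv f (u x) * (v x)\<^sup>2)"
    using stable by (simp add: stable_on_def)
  \<comment> \<open>\<open>G\<close> is the integrand in the variable
    \<open>t = ln (norm x)\<close>; \<open>F\<close> cuts it off to {a..b}, which makes it Borel on
    the whole line.\<close>
  define G where "G t = (z' t)\<^sup>2 * exp (- (2 * t)) - deriv f (w (exp t)) * (z t)\<^sup>2" for t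
  define F where "F t = indicator {a..b} t *\<^sub>R G t" for t
  have cG: "continuous_on {a..b} G"
  proof -
    have sub: "{a..b} \<subseteq> {0<..}" using \<open>0 < a\<close> by auto
    have "continuous_on {0<..} z"
      by (rule DERIV_continuous_on, rule has_field_derivative_at_within, rule dz) simp
    then have "continuous_on {a..b} z" "continuous_on {a..b} z'"
      using cz' sub continuous_on_subset by blast+
    moreover have "continuous_on {a..b} (\<lambda>t. deriv f (w (exp t)))"
      by (intro continuous_on_compose2[OF cf'] continuous_on_compose2[OF cw] continuous_intros)
        (use \<open>0 < a\<close> in auto)
    ultimately show ?thesis
      unfolding G_def by (intro continuous_intros)
  qed
  have F: "F \<in> borel_measurable borel"
    unfolding F_def by (intro borel_measurable_continuous_on_indicator cG) auto
  have "(LINT x:?\<Omega>|lborel. (norm (grad_on ?\<Omega> v x))\<^sup>2 - deriv f (u x) * (v x)\<^sup>2)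
      = (\<integral>x. F (ln (norm (x::real ^ 'n))) \<partial>lborel)"
    unfolding set_lebesgue_integral_def
  proof (intro Bochner_Integration.integral_cong refl)
    fix x :: "real ^ 'n"
    show "indicator ?\<Omega> x *\<^sub>R ((norm (grad_on ?\<Omega> v x))\<^sup>2 - deriv f (u x) * (v x)\<^sup>2) = F (ln (norm x))"
    proof (cases "x \<in> ?\<Omega>")
      case True
      then have n: "1 < norm x" by simp
      define t where "t = ln (norm x)"
      have "0 < norm x" using n by linarith
      then have t: "0 < t" "norm x = exp t"
        unfolding t_def using n by (simp_all add: ln_gt_zero)
      have "u x = w (exp t)" using radial[of x] n unfolding t(2)[symmetric] by simp
      moreover have "(norm (grad_on ?\<Omega> v x))\<^sup>2 = (z' t)\<^sup>2 * exp (- (2 * t))"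
      proof -
        have "norm (grad_on ?\<Omega> v x) = \<bar>z' t\<bar> * exp (- t)"
          unfolding gradv(2)[OF True] t_def[symmetric] norm_scaleR t(2) by (simp add: exp_minus field_simps abs_mult)
        then show ?thesis
          by (simp add: power_mult_distrib flip: exp_double)
      qed
      moreover have "v x = z t" by (simp add: v_def t_def)
      ultimately show ?thesis
        using True z0[OF t(1)] z'0[OF t(1)]
        by (auto simp: F_def G_def t_def[symmetric] split: split_indicator)
    next
      case False
      \<comment> \<open>\<open>F\<close> has to vanish on the closed unit ball too; at the origin
        this rests on \<open>ln 0 = 0 < a\<close>.\<close>
      then have "norm x \<le> 1" by simp
      then have "ln (norm x) \<le> 0"
        by (cases "x = 0") auto
      then show ?thesis
        using False \<open>0 < a\<close> by (simp add: F_def)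
    qed
  qed
  also have "\<dots> = CARD('n) * unit_ball_vol CARD('n) * (\<integral>t. exp (CARD('n) * t) * F t \<partial>lborel)"
    using lborel_integral_ln_norm[OF F, where 'a = "real ^ 'n"] by simp
  also have "(\<integral>t. exp (CARD('n) * t) * F t \<partial>lborel) = (LINT t:{a..b}|lborel. exp (CARD('n) * t) * G t)"
    unfolding set_lebesgue_integral_def F_def
    by (intro Bochner_Integration.integral_cong) (auto split: split_indicator)
  also have "\<dots> = integral {a..b} (\<lambda>t. exp (CARD('n) * t) * G t)"
    by (intro set_borel_integral_eq_integral borel_integrable_atLeastAtMost'
        continuous_intros cG)
  also have "\<dots> = integral {a..b} (\<lambda>t. exp ((real CARD('n) - 2) * t) * (z' t)\<^sup>2
            - exp (CARD('n) * t) * deriv f (w (exp t)) * (z t)\<^sup>2)"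
    by (intro integral_cong) (simp add: G_def algebra_simps exp_diff exp_minus divide_simps)
  finally have "0 \<le> CARD('n) * unit_ball_vol CARD('n) * \<dots>"
    using \<open>0 \<le> (LINT x:?\<Omega>|lborel. _)\<close> by simp
  moreover have "0 < CARD('n) * unit_ball_vol CARD('n)"
    by simp
  ultimately show ?thesis
    by (simp add: zero_le_mult_iff)
qed

section \<open>Growth and decay of the profile\<close>

text \<open>With \<open>W' = exp t * y\<close> and \<open>Q = R y^2\<close> one has
  \<open>W'^2 = exp (2 \<kappa> t) Q\<close>. The factor \<open>exp (- 2 s T)\<close> bounding the
  integral of \<open>1 / Q\<close> or of \<open>Q\<close> then produces the exponents \<kappa> + s
  and \<kappa> - s. The sign \<sigma> makes \<open>\<sigma> * W\<close> nondecreasing from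
  \<open>T0\<close> on.\<close>

lemma log_radial_dichotomy:
  fixes f f' W y y' :: "real \<Rightarrow> real" and n :: nat
  assumes n: "2 \<le> n"
    and dW: "\<And>t. 0 < t \<Longrightarrow> (W has_real_derivative exp t * y t) (at t)"
    and dy: "\<And>t. 0 < t \<Longrightarrow> (y has_real_derivative y' t) (at t)"
    and ode: "\<And>t. 0 < t \<Longrightarrow> y' t = - (real n - 1) * y t - exp t * f (W t)"
    and df: "\<And>x. (f has_real_derivative f' x) (at x)" and cf': "continuous_on UNIV f'"
    and stable: "\<And>z z' a b. 0 < a \<Longrightarrow> a < b \<Longrightarrow>
        (\<And>t. 0 < t \<Longrightarrow> (z has_real_derivative z' t) (at t)) \<Longrightarrow> continuous_on {0<..} z' \<Longrightarrow>
        (\<And>t. 0 < t \<Longrightarrow> t \<notin> {a..b} \<Longrightarrow> z t = 0) \<Longrightarrow>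
        0 \<le> integral {a..b} (\<lambda>t. exp ((real n - 2) * t) * (z' t)\<^sup>2 - exp (real n * t) * f' (W t) * (z t)\<^sup>2)"
  defines "\<kappa> \<equiv> 2 - real n / 2" and "s \<equiv> sqrt (real n - 1)"
  obtains \<sigma> T0 where "0 < T0" "\<bar>\<sigma>\<bar> = 1" "\<And>t. T0 \<le> t \<Longrightarrow> 0 \<le> \<sigma> * (exp t * y t)"
    "(\<exists>c>0. \<forall>T\<ge>T0. c * exp ((\<kappa> + s) * T) \<le> \<sigma> * (W (T+1) - W T)) \<or>
     (\<exists>C. \<forall>T\<ge>T0. \<forall>t\<in>{T..T+1}. \<bar>W t - W T\<bar> \<le> C * exp ((\<kappa> - s) * T))"
proof -
  define R where "R t = exp ((real n - 2) * t)" for t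
  define S where "S t = exp (real n * t) * f' (W t)" for t
  define m where "m = real n - 1"
  define Q where "Q t = R t * (y t)\<^sup>2" for t
  have m: "0 < m" "s\<^sup>2 = m" "s \<noteq> 0"
    using n by (auto simp: m_def s_def)
  have cR: "continuous_on A R" for A
    unfolding R_def by (intro continuous_intros)
  have Rpos: "0 < R t" for t by (simp add: R_def)
  have cW: "continuous_on {0<..} W" and cy: "continuous_on {0<..} y"
    by (rule DERIV_continuous_on, rule has_field_derivative_at_within, rule dW dy, simp)+
  have cf: "continuous_on UNIV f"
    by (rule DERIV_continuous_on, rule df)
  have cS: "continuous_on {0<..} S"
    unfolding S_def by (intro continuous_intros cW continuous_on_compose2[OF cf']) auto
  have cQ: "continuous_on {0<..} Q"
    unfolding Q_def by (intro continuous_intros cR cy)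
  have cy': "continuous_on {0<..} y'"
  proof -
    have "continuous_on {0<..} (\<lambda>t. - (real n - 1) * y t - exp t * f (W t))"
      by (intro continuous_intros cy cW continuous_on_compose2[OF cf]) auto
    then show ?thesis
      by (rule continuous_on_eq) (simp add: ode)
  qed
  have dRy': "((\<lambda>t. R t * y' t) has_real_derivative (m * R t - S t) * y t) (at t)" if "0 < t" for t :: real
  proof -
    define X where "X t = exp ((real n - 1) * t)" for t
    have dfW: "((\<lambda>t. f (W t)) has_real_derivative f' (W t) * (exp t * y t)) (at t)"
      using DERIV_chain2[OF df dW[OF that]] .
    have dR: "(R has_real_derivative (real n - 2) * R t) (at t)"
      unfolding R_def[abs_def] by (auto intro!: derivative_eq_intros)
    have dX: "(X has_real_derivative m * X t) (at t)"
      unfolding X_def[abs_def] m_def by (auto intro!: derivative_eq_intros)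
    have e: "R t * exp t = X t" "X t * exp t = exp (real n * t)"
      by (simp_all add: R_def X_def algebra_simps flip: exp_add)
    \<comment> \<open>By the equation \<open>R y'\<close> equals this expression in \<open>y\<close>
      and \<open>W\<close>, which can be differentiated although only \<open>y'\<close> is given.
      Inserting the equation once more removes \<open>f\<close>.\<close>
    have "((\<lambda>t. - m * (R t * y t) - X t * f (W t)) has_real_derivative
        - m * ((real n - 2) * R t * y t + y' t * R t) - (m * X t * f (W t) + f' (W t) * (exp t * y t) * X t)) (at t)"
      by (intro DERIV_diff DERIV_cmult DERIV_mult dR dX dfW dy[OF that])
    also have "- m * ((real n - 2) * R t * y t + y' t * R t) - (m * X t * f (W t) + f' (W t) * (exp t * y t) * X t)
        = (m * R t - S t) * y t"
      unfolding ode[OF that] S_def e(2)[symmetric] e(1)[symmetric] m_def by (simp add: algebra_simps)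
    finally show ?thesis
    proof (rule has_field_derivative_transform_within_open[of _ _ _ "{0<..}"])
      fix t' :: real assume "t' \<in> {0<..}"
      moreover have "R t' * exp t' = X t'"
        by (simp add: R_def X_def algebra_simps flip: exp_add)
      ultimately show "- m * (R t' * y t') - X t' * f (W t') = R t' * y' t'"
        by (simp add: ode m_def algebra_simps)
    qed (use that in auto)
  qed
  have nonneg: "0 \<le> e" if "bridge R S a 0 b 0 e" "0 < a" for a b e
    using stable that
    by (intro bridge_zero_nonneg[OF cR cS _ that]) (simp add: R_def[abs_def] S_def[abs_def])
  \<comment> \<open>A path from 0 to 0 remains one after multiplication by \<open>y\<close>, and its
    boundary terms vanish, so the energy is unchanged.\<close>
  have nonnegQ: "0 \<le> e" if "0 < a" "bridge Q (\<lambda>t. s\<^sup>2 * Q t) a 0 b 0 e" for a b e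
    using nonneg[of a b e] bridge_mult[OF cR dy cy' dRy' \<open>0 < a\<close>, of 0 b 0 e] that
    unfolding m(2) by (simp add: Q_def[abs_def])
  have zeros: "y t = 0" if "0 < a" "y a = 0" "y b = 0" "t \<in> {a..b}" for a b t
    using zero_between_zeros[OF cR Rpos m(1) dy cy' dRy' nonneg that] .
  have Wy: "(exp t * y t)\<^sup>2 = exp (2 * \<kappa> * t) * Q t" for t
    unfolding Q_def R_def \<kappa>_def power_mult_distrib exp_double[symmetric]
    by (simp add: algebra_simps flip: exp_add)
  show ?thesis
  proof (cases "\<exists>T0>0. \<forall>t\<ge>T0. y t \<noteq> 0")
    case False
    \<comment> \<open>Zeros of \<open>y\<close> occur arbitrarily late. As \<open>y\<close> vanishes
      between any two of them, it is 0 from \<open>a\<close> on, \<open>W\<close> is constant there,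
      and the second alternative holds with constant 0.\<close>
    then have ex0: "\<exists>b\<ge>t. y b = 0" if "0 < t" for t
      using that by blast
    then obtain a where a: "1 \<le> a" "y a = 0"
      using zero_less_one by blast
    have y0: "y t = 0" if t: "a \<le> t" for t
    proof -
      obtain b where "t \<le> b" "y b = 0"
        using ex0[of t] a t by auto
      then show ?thesis
        using zeros[of a b t] a t by auto
    qed
    have const: "W t = W T" if "a \<le> T" "t \<in> {T..T+1}" for t T
    proof (cases "T = t")
      case False
      then have "T < t" using that by auto
      then show ?thesis
      proof (rule DERIV_isconst_end)
        show "continuous_on {T..t} W"
          using a that by (intro continuous_on_subset[OF cW]) auto
        show "(W has_real_derivative 0) (at r)" if "T < r" "r < t" for r
          using dW[of r] y0[of r] a that \<open>a \<le> T\<close> by simp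
      qed
    qed simp
    show ?thesis
    proof (rule that[of a 1])
      have "\<bar>W t - W T\<bar> \<le> 0 * exp ((\<kappa> - s) * T)" if "a \<le> T" "t \<in> {T..T+1}" for t T
        using const[OF that] by simp
      then show "(\<exists>c>0. \<forall>T\<ge>a. c * exp ((\<kappa> + s) * T) \<le> 1 * (W (T+1) - W T)) \<or>
          (\<exists>C. \<forall>T\<ge>a. \<forall>t\<in>{T..T+1}. \<bar>W t - W T\<bar> \<le> C * exp ((\<kappa> - s) * T))"
        by (intro disjI2 exI[of _ 0] allI impI ballI)
    qed (use a y0 in auto)
  next
    case True
    then obtain T0 where T0: "0 < T0" "\<And>t. T0 \<le> t \<Longrightarrow> y t \<noteq> 0" by blast
    \<comment> \<open>By the intermediate value theorem \<open>y\<close> keeps the sign it has at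
      \<open>T0\<close>.\<close>
    define \<sigma> where "\<sigma> = sgn (y T0)"
    have \<sigma>: "\<bar>\<sigma>\<bar> = 1" using T0 by (simp add: \<sigma>_def abs_sgn_eq)
    have pos: "0 < \<sigma> * y t" if t: "T0 \<le> t" for t
    proof (rule ccontr)
      assume "\<not> 0 < \<sigma> * y t"
      then have "\<sigma> * y t \<le> 0" by simp
      moreover have "0 \<le> \<sigma> * y T0" by (simp add: \<sigma>_def sgn_if)
      moreover have "continuous_on {T0..t} (\<lambda>t. \<sigma> * y t)"
        using T0 by (intro continuous_intros continuous_on_subset[OF cy]) auto
      ultimately obtain x where "T0 \<le> x" "x \<le> t" "\<sigma> * y x = 0"
        using IVT2'[of "\<lambda>t. \<sigma> * y t" t 0 T0] t by blast
      then show False using T0(2)[of x] \<sigma> by auto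
    qed
    have posW: "0 < \<sigma> * (exp t * y t)" if "T0 \<le> t" for t
      using mult_pos_pos[OF exp_gt_zero pos[OF that], of t] by (simp only: mult.left_commute)
    have Qpos: "0 < Q t" if "T0 \<le> t" for t
      using T0(2)[OF that] Rpos[of t] by (simp add: Q_def)
    show ?thesis
    \<comment> \<open>The condition \<open>T0 \<le> b\<close> ensures \<open>0 < Q\<close> from the
      stopping time on, as the optimal descent requires.\<close>
    proof (cases "\<exists>a b x e. 0 < a \<and> e < 0 \<and> bridge Q (\<lambda>t. s\<^sup>2 * Q t) a 0 b x e \<and> T0 \<le> b")
      case True
      then obtain a b x e where br: "0 < a" "e < 0" "bridge Q (\<lambda>t. s\<^sup>2 * Q t) a 0 b x e" "T0 \<le> b" by blast
      have "\<exists>C>0. \<forall>T>b. integral {T..T+1} (\<lambda>t. 1 / Q t) \<le> C * exp (- 2 * s * T)"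
        by (rule integral_inverse_le_of_negative_energy[OF cQ _ br(1,3,2)])
          (use br(4) in \<open>blast intro: nonnegQ, auto intro: Qpos\<close>)
      then obtain C where C: "0 < C"
          "\<And>T. b < T \<Longrightarrow> integral {T..T+1} (\<lambda>t. 1 / Q t) \<le> C * exp (- 2 * s * T)"
        by blast
      have "exp (- \<bar>\<kappa>\<bar>) / sqrt C * exp ((\<kappa> + s) * T) \<le> \<sigma> * W (T+1) - \<sigma> * W T" if "b + 1 \<le> T" for T
      proof (rule increment_lower_bound[where V' = "\<lambda>t. \<sigma> * (exp t * y t)" and Q = Q])
        show "((\<lambda>t. \<sigma> * W t) has_real_derivative \<sigma> * (exp t * y t)) (at t)" if "t \<in> {T..T+1}" for t
          using that \<open>b + 1 \<le> T\<close> br(4) T0(1) by (intro DERIV_cmult dW) auto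
        show "continuous_on {T..T+1} (\<lambda>t. \<sigma> * (exp t * y t))"
          using that br(4) T0(1) by (intro continuous_intros continuous_on_subset[OF cy]) auto
        show "0 < \<sigma> * (exp t * y t)" if "t \<in> {T..T+1}" for t
          using posW[of t] that \<open>b + 1 \<le> T\<close> br(4) by simp
        show "(\<sigma> * (exp t * y t))\<^sup>2 = exp (2 * \<kappa> * t) * Q t" for t
        proof -
          have "\<sigma>\<^sup>2 = 1" using \<sigma> by (metis one_power2 power2_abs)
          then show ?thesis
            by (subst power_mult_distrib) (simp add: Wy)
        qed
      qed (use C that in auto)
      then have inc: "\<forall>T\<ge>b+1. exp (- \<bar>\<kappa>\<bar>) / sqrt C * exp ((\<kappa> + s) * T) \<le> \<sigma> * (W (T+1) - W T)"
        by (simp add: right_diff_distrib)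
      have "0 < exp (- \<bar>\<kappa>\<bar>) / sqrt C"
        using C(1) by simp
      with inc show ?thesis
        using T0(1) \<sigma> br(4) posW by (intro that[of "b + 1" \<sigma>]) (auto intro!: less_imp_le[OF posW])
    next
      case False
      have "0 \<le> e" if "0 < a" "bridge Q (\<lambda>t. s\<^sup>2 * Q t) a 0 b x e" for a b x e
      proof (rule ccontr)
        assume "\<not> 0 \<le> e"
        \<comment> \<open>A negative energy reached before \<open>T0\<close> is carried past
          \<open>T0\<close> along a zero-energy multiple of \<open>exp (- s t)\<close>, so the
          negated case excludes it as well.\<close>
        define T where "T = max b T0 + 1"
        have "b < T" by (simp add: T_def)
        have "0 < b" using that by (simp add: bridge_def)
        have "bridge Q (\<lambda>t. s\<^sup>2 * Q t) b (x * exp (- s * (b - b))) T (x * exp (- s * (T - b)))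
            (integral {b..T} (\<lambda>t. Q t * (- s * x * exp (- s * (t - b)))\<^sup>2
                - s\<^sup>2 * Q t * (x * exp (- s * (t - b)))\<^sup>2))"
          using \<open>0 < b\<close>
          by (intro bridge_smooth[OF \<open>b < T\<close>])
            (auto intro!: continuous_intros continuous_on_subset[OF cQ] derivative_eq_intros)
        then have "bridge Q (\<lambda>t. s\<^sup>2 * Q t) b x T (x * exp (- s * (T - b))) 0"
          by (simp add: power_mult_distrib mult_ac)
        from bridge_trans[OF that(2) this] False that(1) \<open>\<not> 0 \<le> e\<close> show False
          by (force simp: T_def)
      qed
      then have "\<exists>C. \<forall>T>2. integral {T..T+1} Q \<le> C * exp (- 2 * s * T)"
        by (intro integral_le_of_nonneg_energy[OF cQ m(3)])
      then obtain C where C: "\<And>T. 2 < T \<Longrightarrow> integral {T..T+1} Q \<le> C * exp (- 2 * s * T)" by blast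
      have "\<bar>W t - W T\<bar> \<le> exp \<bar>\<kappa>\<bar> * ((C + 1) / 2) * exp ((\<kappa> - s) * T)"
        if T: "T0 + 3 \<le> T" and t: "t \<in> {T..T+1}" for T t
      proof (rule increment_upper_bound[OF _ _ _ _ t])
        show "(W has_real_derivative exp t * y t) (at t)" if "t \<in> {T..T+1}" for t
          using that T T0(1) by (intro dW) auto
        show "continuous_on {T..T+1} (\<lambda>t. exp t * y t)"
          using T T0(1) by (intro continuous_intros continuous_on_subset[OF cy]) auto
        show "integral {T..T+1} Q \<le> C * exp (- 2 * s * T)"
          using C[of T] T T0(1) by auto
      qed (rule Wy)
      then have "\<exists>C. \<forall>T\<ge>T0+3. \<forall>t\<in>{T..T+1}. \<bar>W t - W T\<bar> \<le> C * exp ((\<kappa> - s) * T)"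
        by blast
      then show ?thesis
        using T0(1) \<sigma> by (intro that[OF _ _ _ disjI2]) (auto intro!: less_imp_le[OF posW])
    qed
  qed
qed

section \<open>From increments over unit time to behaviour at infinity\<close>

lemma mono_tendsto_ereal:
  fixes V :: "real \<Rightarrow> real"
  assumes mono: "\<And>r t. T \<le> r \<Longrightarrow> r \<le> t \<Longrightarrow> V r \<le> V t"
  obtains l where "((\<lambda>t. ereal (V t)) \<longlongrightarrow> l) at_top" "\<And>t. T \<le> t \<Longrightarrow> ereal (V t) \<le> l"
proof
  define l where "l = (SUP t\<in>{T..}. ereal (V t))"
  show le: "ereal (V t) \<le> l" if "T \<le> t" for t
    unfolding l_def using that by (intro SUP_upper) auto
  show "((\<lambda>t. ereal (V t)) \<longlongrightarrow> l) at_top"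
  proof (rule order_tendstoI)
    fix a assume "a < l"
    then obtain r where r: "T \<le> r" "a < ereal (V r)"
      unfolding l_def less_SUP_iff by auto
    show "\<forall>\<^sub>F t in at_top. a < ereal (V t)"
      using eventually_ge_at_top[of r]
    proof eventually_elim
      case (elim t)
      then have "ereal (V r) \<le> ereal (V t)" using mono[OF r(1)] by simp
      with r(2) show ?case by (rule less_le_trans)
    qed
  next
    fix a assume "l < a"
    show "\<forall>\<^sub>F t in at_top. ereal (V t) < a"
      using eventually_ge_at_top[of T]
      by eventually_elim (use le \<open>l < a\<close> in \<open>auto intro: le_less_trans\<close>)
  qed
qed

text \<open>The increment over [t - 1, t] alone is of order \<open>exp (\<beta> t)\<close>;
  monotonicity bounds what precedes it below by \<open>V T\<close>.\<close>

lemma exp_growth_of_increments: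
  fixes V :: "real \<Rightarrow> real"
  assumes mono: "\<And>r t. T \<le> r \<Longrightarrow> r \<le> t \<Longrightarrow> V r \<le> V t"
    and inc: "\<And>t. T \<le> t \<Longrightarrow> c * exp (\<beta> * t) \<le> V (t+1) - V t"
    and "0 < c" "0 < \<beta>"
  shows "\<exists>M>0. \<forall>\<^sub>F t in at_top. M * exp (\<beta> * t) \<le> V t"
proof (intro exI conjI)
  \<comment> \<open>Half the coefficient of the last increment; the other half absorbs
    \<open>V T\<close> once \<open>exp (\<beta> t)\<close> is large.\<close>
  define M where "M = c * exp (- \<beta>) / 2"
  show "0 < M" using \<open>0 < c\<close> by (simp add: M_def)
  have "filterlim (\<lambda>t. exp (\<beta> * t)) at_top at_top"
    using \<open>0 < \<beta>\<close>
    by (intro filterlim_compose[OF exp_at_top] filterlim_tendsto_pos_mult_at_top[OF tendsto_const] filterlim_ident)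
  then have "\<forall>\<^sub>F t in at_top. - V T / M \<le> exp (\<beta> * t)"
    by (simp add: filterlim_at_top)
  then show "\<forall>\<^sub>F t in at_top. M * exp (\<beta> * t) \<le> V t"
    using eventually_ge_at_top[of "T + 1"]
  proof eventually_elim
    case (elim t)
    have "c * exp (\<beta> * (t - 1)) \<le> V t - V (t - 1)"
      using inc[of "t - 1"] elim by simp
    moreover have "c * exp (\<beta> * (t - 1)) = 2 * (M * exp (\<beta> * t))"
      by (simp add: M_def algebra_simps exp_diff exp_minus divide_simps)
    moreover have "V T \<le> V (t - 1)" using mono[of T "t - 1"] elim by simp
    moreover have "- V T \<le> M * exp (\<beta> * t)"
      using elim(1) \<open>0 < M\<close> by (simp add: field_simps)
    ultimately show ?case by linarith
  qed
qed

text \<open>Here the increments must be summed: about \<open>t - T\<close> unit steps gain at least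
  \<open>c\<close> each, and halving the slope absorbs the constants.\<close>

lemma linear_growth_of_increments:
  fixes V :: "real \<Rightarrow> real"
  assumes mono: "\<And>r t. T \<le> r \<Longrightarrow> r \<le> t \<Longrightarrow> V r \<le> V t"
    and inc: "\<And>t. T \<le> t \<Longrightarrow> c \<le> V (t+1) - V t"
    and "0 < c"
  shows "\<forall>\<^sub>F t in at_top. c / 2 * t \<le> V t"
proof -
  have steps: "V T + c * real k \<le> V (T + real k)" for k
  proof (induction k)
    case (Suc k)
    then show ?case
      using inc[of "T + real k"] by (simp add: algebra_simps)
  qed simp
  \<comment> \<open>The second threshold is the time from which
    \<open>c / 2 * t \<le> V T + c * (t - T - 1)\<close>.\<close>
  show ?thesis
    using eventually_ge_at_top[of T] eventually_ge_at_top[of "2 * (T + 1 - V T / c)"]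
  proof eventually_elim
    case (elim t)
    define k where "k = nat \<lfloor>t - T\<rfloor>"
    have k: "real k \<le> t - T" "t - T \<le> real k + 1"
      using elim(1) by (auto simp: k_def)
    have "c / 2 * t \<le> V T + c * (t - T - 1)"
      using elim(2) \<open>0 < c\<close> by (simp add: field_simps)
    also have "\<dots> \<le> V T + c * real k"
      using k \<open>0 < c\<close> by simp
    also have "\<dots> \<le> V (T + real k)" by (rule steps)
    also have "\<dots> \<le> V t" using k by (intro mono) auto
    finally show ?case .
  qed
qed

text \<open>The constant is the sum of a geometric series of ratio \<open>exp \<gamma>\<close>. It
  solves \<open>D * exp \<gamma> + C = D\<close>, which closes an induction on the number of unit
  steps with moving starting time.\<close>

lemma exp_decay_of_increments:
  fixes W :: "real \<Rightarrow> real"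
  assumes inc: "\<And>T t. T0 \<le> T \<Longrightarrow> t \<in> {T..T+1} \<Longrightarrow> \<bar>W t - W T\<bar> \<le> C * exp (\<gamma> * T)"
    and "\<gamma> < 0" and "T0 \<le> T" "T \<le> t"
  shows "\<bar>W t - W T\<bar> \<le> C / (1 - exp \<gamma>) * exp (\<gamma> * T)"
proof -
  define D where "D = C / (1 - exp \<gamma>)"
  have e: "0 < 1 - exp \<gamma>" using \<open>\<gamma> < 0\<close> by simp
  have D: "C = D * (1 - exp \<gamma>)" using e by (simp add: D_def)
  have "0 \<le> C * exp (\<gamma> * T0)"
    using inc[of T0 T0] by simp
  then have "0 \<le> C" by (simp add: zero_le_mult_iff)
  then have "0 \<le> D" using e by (simp add: D_def)
  have "\<bar>W t - W T\<bar> \<le> D * exp (\<gamma> * T)" if "T0 \<le> T" "T \<le> t" "t \<le> T + real k" for k T t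
    using that
  proof (induction k arbitrary: T)
    case 0
    then show ?case using \<open>0 \<le> D\<close> by simp
  next
    case (Suc k)
    show ?case
    proof (cases "t \<le> T + 1")
      case True
      then have "\<bar>W t - W T\<bar> \<le> C * exp (\<gamma> * T)"
        using inc Suc.prems by auto
      also have "\<dots> \<le> D * exp (\<gamma> * T)"
        unfolding D using \<open>0 \<le> D\<close> by (intro mult_right_mono mult_left_le) auto
      finally show ?thesis .
    next
      case False
      have "\<bar>W t - W (T + 1)\<bar> \<le> D * exp (\<gamma> * (T + 1))"
        using Suc.prems False by (intro Suc.IH) auto
      moreover have "\<bar>W (T + 1) - W T\<bar> \<le> C * exp (\<gamma> * T)"
        using inc[of T "T + 1"] Suc.prems by auto
      moreover have "D * exp (\<gamma> * (T + 1)) + C * exp (\<gamma> * T) = D * exp (\<gamma> * T)"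
        unfolding D by (simp add: algebra_simps exp_add)
      ultimately show ?thesis by linarith
    qed
  qed
  from this[of T t "nat \<lceil>t - T\<rceil>"] show ?thesis
    using assms(3,4) unfolding D_def by (simp add: le_nat_iff) linarith
qed

text \<open>Full unit steps and one partial step contribute at most \<open>C\<close> each; the
  partial step accounts for the summand 1.\<close>

lemma linear_bound_of_increments:
  fixes W :: "real \<Rightarrow> real"
  assumes inc: "\<And>T t. T0 \<le> T \<Longrightarrow> t \<in> {T..T+1} \<Longrightarrow> \<bar>W t - W T\<bar> \<le> C"
    and "T0 \<le> t"
  shows "\<bar>W t - W T0\<bar> \<le> C * (t - T0 + 1)"
proof -
  have "0 \<le> C" using inc[of T0 T0] by simp
  define k where "k = nat \<lfloor>t - T0\<rfloor>"
  have k: "real k \<le> t - T0" "t - T0 \<le> real k + 1"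
    using assms(2) by (auto simp: k_def)
  have steps: "\<bar>W (T0 + real j) - W T0\<bar> \<le> C * real j" for j
  proof (induction j)
    case (Suc j)
    then show ?case
      using inc[of "T0 + real j" "T0 + real (Suc j)"] by (simp add: algebra_simps)
  qed simp
  have "\<bar>W t - W (T0 + real k)\<bar> \<le> C"
    using k by (intro inc) auto
  with steps[of k] have "\<bar>W t - W T0\<bar> \<le> C * (real k + 1)"
    by (simp add: algebra_simps)
  also have "\<dots> \<le> C * (t - T0 + 1)"
    using k \<open>0 \<le> C\<close> by (intro mult_left_mono) auto
  finally show ?thesis .
qed

text \<open>The bound confines \<open>V\<close> eventually to a bounded interval, which also
  excludes an infinite \<open>l\<close>.\<close>

lemma ereal_dist_limit_le:
  fixes V :: "real \<Rightarrow> real"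
  assumes lim: "((\<lambda>t. ereal (V t)) \<longlongrightarrow> l) at_top"
    and le: "\<And>t. T \<le> t \<Longrightarrow> \<bar>V t - v\<bar> \<le> B"
  shows "\<bar>ereal v - l\<bar> \<le> ereal B"
proof -
  have "\<forall>\<^sub>F t in at_top. ereal (V t) \<le> ereal (v + B)" "\<forall>\<^sub>F t in at_top. ereal (v - B) \<le> ereal (V t)"
    using eventually_ge_at_top[of T] by (eventually_elim, use le in \<open>force simp: abs_le_iff\<close>)+
  then have "l \<le> ereal (v + B)" "ereal (v - B) \<le> l"
    using tendsto_upperbound[OF lim] tendsto_lowerbound[OF lim] by auto
  then show ?thesis
    by (cases l) auto
qed

lemma growth_contradicts_limit:
  fixes w :: "real \<Rightarrow> real"
  assumes lim: "((\<lambda>r. ereal (w r)) \<longlongrightarrow> ereal L) at_top"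
    and g: "filterlim g at_top at_top" "\<And>r. r0 \<le> r \<Longrightarrow> g r \<le> \<bar>w r\<bar>"
  shows False
proof -
  have "((\<lambda>r. \<bar>w r\<bar>) \<longlongrightarrow> \<bar>L\<bar>) at_top"
    using lim by (auto intro: tendsto_rabs)
  then have "\<forall>\<^sub>F r in at_top. \<bar>w r\<bar> < \<bar>L\<bar> + 1"
    by (rule order_tendstoD) simp
  moreover have "\<forall>\<^sub>F r in at_top. \<bar>L\<bar> + 1 \<le> g r"
    using g(1) by (simp add: filterlim_at_top)
  ultimately have "\<forall>\<^sub>F r in (at_top :: real filter). False"
    using eventually_ge_at_top[of r0]
  proof eventually_elim
    case (elim r)
    then show ?case using g(2)[of r] by linarith
  qed
  then show False by simp
qed

section \<open>The exponents and the incompatibility of (L) and (S)\<close>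

lemma powr_at_top:
  assumes "0 < \<beta>" "0 < (M::real)"
  shows "filterlim (\<lambda>r. M * r powr \<beta>) at_top at_top"
  using assms
  by (intro filterlim_tendsto_pos_mult_at_top[OF tendsto_const] real_powr_at_top)

text \<open>The critical dimension 10 comes from
  \<open>(n / 2 - 2)^2 - (n - 1) = (n - 2) (n - 10) / 4\<close>; for \<open>n \<le> 4\<close> the
  first bound is immediate.\<close>

lemma sqrt_exponent_bounds:
  assumes "2 \<le> n"
  shows "n \<le> 9 \<Longrightarrow> 0 < - real n / 2 + sqrt (real n - 1) + 2"
    and "n = 10 \<Longrightarrow> - real n / 2 + sqrt (real n - 1) + 2 = 0"
    and "3 \<le> n \<Longrightarrow> - real n / 2 - sqrt (real n - 1) + 2 < 0"
    and "n = 2 \<Longrightarrow> - real n / 2 - sqrt (real n - 1) + 2 = 0"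
    and "0 < sqrt (real n - 1)"
proof -
  show "0 < - real n / 2 + sqrt (real n - 1) + 2" if "n \<le> 9"
  proof (cases "n \<le> 4")
    case True
    then have "real n \<le> 4" by simp
    moreover have "0 < sqrt (real n - 1)" using assms by simp
    ultimately show ?thesis by linarith
  next
    case False
    have "0 < (real n - 2) * (10 - real n)"
      using False that by (intro mult_pos_pos) auto
    then have "(real n / 2 - 2)\<^sup>2 < real n - 1"
      by (simp add: power2_eq_square field_simps)
    then have "real n / 2 - 2 < sqrt (real n - 1)"
      by (rule real_less_rsqrt)
    then show ?thesis by simp
  qed
  show "- real n / 2 + sqrt (real n - 1) + 2 = 0" if "n = 10"
    using that by (simp add: real_sqrt_unique)
  show "- real n / 2 - sqrt (real n - 1) + 2 < 0" if "3 \<le> n"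
  proof -
    have "1 < sqrt (real n - 1)" "3 \<le> real n" using that by auto
    then show ?thesis by linarith
  qed
qed (use assms in auto)

text \<open>For \<open>n = 2\<close> quadratic growth beats the logarithm. For larger
  \<open>n\<close> condition (S) forces a finite limit: this contradicts the unbounded lower bound
  up to \<open>n = 10\<close>, and afterwards the two powers of \<open>r\<close> are
  incompatible.\<close>

lemma cond_L_cond_S_exclusive:
  assumes n: "2 \<le> n" and lim: "((\<lambda>r. ereal (w r)) \<longlongrightarrow> l) at_top"
    and L: "cond_L n w l" and S: "cond_S n w l"
  shows False
proof -
  define \<beta> where "\<beta> = - real n / 2 + sqrt (real n - 1) + 2"
  define \<gamma> where "\<gamma> = - real n / 2 - sqrt (real n - 1) + 2"
  obtain M r0 where M: "0 < M" "1 \<le> r0"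
      "\<And>r. n \<le> 9 \<Longrightarrow> r0 \<le> r \<Longrightarrow> M * r powr \<beta> \<le> \<bar>w r\<bar>"
      "\<And>r. n = 10 \<Longrightarrow> r0 \<le> r \<Longrightarrow> M * ln r \<le> \<bar>w r\<bar>"
      "\<And>r. 11 \<le> n \<Longrightarrow> r0 \<le> r \<Longrightarrow> ereal (M * r powr \<beta>) \<le> \<bar>ereal (w r) - l\<bar>"
    using L n unfolding cond_L_def \<beta>_def[symmetric] by blast
  obtain M' where M': "0 < M'"
      "\<And>r. n = 2 \<Longrightarrow> 2 \<le> r \<Longrightarrow> \<bar>w r\<bar> \<le> M' * ln r"
      "\<And>r. 3 \<le> n \<Longrightarrow> 1 \<le> r \<Longrightarrow> \<bar>ereal (w r) - l\<bar> \<le> ereal (M' * r powr \<gamma>)"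
    using S unfolding cond_S_def \<gamma>_def[symmetric] by blast
  show False
  proof (cases "n = 2")
    case True
    then have "\<beta> = 2" by (simp add: \<beta>_def)
    \<comment> \<open>Large enough that \<open>M * r \<ge> M'\<close>; with \<open>ln r < r\<close>
      this gives \<open>M' * ln r < M * r^2\<close>.\<close>
    define r where "r = max r0 2 + M' / M"
    have "0 < M' / M" using M M' by simp
    then have r: "r0 \<le> r" "2 \<le> r" "M' / M \<le> r" "0 < r"
      using M(2) by (auto simp: r_def)
    have "M * (r * r) = M * r powr \<beta>"
      using r by (simp add: \<open>\<beta> = 2\<close> power2_eq_square)
    also have "\<dots> \<le> M' * ln r"
      using M(3)[of r] M'(2)[of r] r True by simp
    also have "ln r < r"
      using ln_le_minus_one[of r] r by linarith
    then have "M' * ln r < M' * r" using M' by simp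
    also have "\<dots> \<le> M * r * r"
      using r(3,4) M(1) by (intro mult_right_mono) (auto simp: field_simps)
    finally show False by (simp add: mult.assoc)
  next
    case False
    then have n3: "3 \<le> n" using n by simp
    \<comment> \<open>A finite distance at the single radius 1 makes \<open>l\<close> real.\<close>
    have "\<bar>ereal (w 1) - l\<bar> \<le> ereal (M' * 1 powr \<gamma>)"
      using M'(3)[OF n3, of 1] by simp
    then obtain x where x: "l = ereal x"
      by (cases l) auto
    note lim' = lim[unfolded x]
    consider "n \<le> 9" | "n = 10" | "11 \<le> n" by linarith
    then show False
    proof cases
      case 1
      then show False
        using growth_contradicts_limit[OF lim' powr_at_top, of \<beta> M r0] sqrt_exponent_bounds(1)[OF n] M
        by (simp add: \<beta>_def)
    next
      case 2
      have "filterlim (\<lambda>r. M * ln r) at_top at_top"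
        using M(1) by (intro filterlim_tendsto_pos_mult_at_top[OF tendsto_const] ln_at_top)
      then show False
        using growth_contradicts_limit[OF lim', of "\<lambda>r. M * ln r" r0] M(4)[OF 2] by blast
    next
      case 3
      \<comment> \<open>The difference of the exponents is \<open>2 * sqrt (real n - 1)\<close>, so
        the quotient of the two bounds diverges.\<close>
      have "filterlim (\<lambda>r. M * r powr (\<beta> - \<gamma>)) at_top at_top"
        using sqrt_exponent_bounds(5)[OF n] M(1) by (intro powr_at_top) (auto simp: \<beta>_def \<gamma>_def)
      then have "\<forall>\<^sub>F r in at_top. M' + 1 \<le> M * r powr (\<beta> - \<gamma>)"
        by (simp add: filterlim_at_top)
      then have "\<forall>\<^sub>F r in (at_top :: real filter). False"
        using eventually_ge_at_top[of r0]
      proof eventually_elim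
        case (elim r)
        then have r: "1 \<le> r" using M(2) by simp
        have "ereal (M * r powr \<beta>) \<le> ereal (M' * r powr \<gamma>)"
          using M(5)[OF 3 elim(2)] M'(3)[OF n3 r] by (rule order_trans)
        then have "M * (r powr \<beta> / r powr \<gamma>) \<le> M'"
          using r by (simp add: field_simps)
        then have "M * r powr (\<beta> - \<gamma>) \<le> M'"
          by (simp add: powr_diff)
        then show ?case using elim(1) by linarith
      qed
      then show False by simp
    qed
  qed
qed

section \<open>Deriving (L) and (S) from the increments\<close>

text \<open>The ranges of \<open>n\<close> are those of a positive, zero and negative exponent. In
  the first the last increment dominates, in the second the increments add up to a multiple of
  \<open>ln r\<close>, and in the third the next increment is part of the remaining distance to
  \<open>l\<close>.\<close>

lemma cond_L_of_growth:
  assumes n: "2 \<le> n"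
    and mono: "\<And>r t. T0 \<le> r \<Longrightarrow> r \<le> t \<Longrightarrow> \<sigma> * w (exp r) \<le> \<sigma> * w (exp t)"
    and \<sigma>: "\<bar>\<sigma>\<bar> = 1" and "0 < c"
    and inc: "\<And>T. T0 \<le> T \<Longrightarrow>
      c * exp ((- real n / 2 + sqrt (real n - 1) + 2) * T) \<le> \<sigma> * w (exp (T + 1)) - \<sigma> * w (exp T)"
    and dist: "\<And>t. T0 \<le> t \<Longrightarrow> ereal (\<sigma> * w (exp (t + 1)) - \<sigma> * w (exp t)) \<le> \<bar>ereal (w (exp t)) - l\<bar>"
  shows "cond_L n w l"
proof -
  define \<beta> where "\<beta> = - real n / 2 + sqrt (real n - 1) + 2"
  note inc = inc[folded \<beta>_def]
  have le_abs: "\<sigma> * x \<le> \<bar>x\<bar>" for x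
    using \<sigma> by (metis abs_ge_self abs_mult mult_1)
  have ev: "\<exists>r0\<ge>1. \<forall>r\<ge>r0. P (ln r) r" if ev: "\<forall>\<^sub>F t in at_top. P t (exp t)" for P :: "real \<Rightarrow> real \<Rightarrow> bool"
  proof -
    obtain T where T: "\<And>t. T \<le> t \<Longrightarrow> P t (exp t)"
      using ev by (auto simp: eventually_at_top_linorder)
    have "P (ln r) r" if "max 1 (exp T) \<le> r" for r
      using T[of "ln r"] that by (simp add: ln_ge_iff)
    then show ?thesis by (intro exI[of _ "max 1 (exp T)"]) auto
  qed
  have powr: "r powr \<beta> = exp (\<beta> * ln r)" if "1 \<le> r" for r
    using that by (simp add: powr_def)
  consider "n \<le> 9" | "n = 10" | "11 \<le> n" by linarith
  then show ?thesis
  proof cases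
    case 1
    then have "0 < \<beta>" using sqrt_exponent_bounds(1)[OF n] by (simp add: \<beta>_def)
    from exp_growth_of_increments[OF mono inc \<open>0 < c\<close> this]
    obtain M where "0 < M" and M: "\<forall>\<^sub>F t in at_top. M * exp (\<beta> * t) \<le> \<sigma> * w (exp t)" by blast
    have "\<forall>\<^sub>F t in at_top. M * exp (\<beta> * t) \<le> \<bar>w (exp t)\<bar>"
      using M by eventually_elim (use le_abs in \<open>blast intro: order_trans\<close>)
    then obtain r0 where "1 \<le> r0" "\<And>r. r0 \<le> r \<Longrightarrow> M * exp (\<beta> * ln r) \<le> \<bar>w r\<bar>"
      using ev[of "\<lambda>t r. M * exp (\<beta> * t) \<le> \<bar>w r\<bar>"] by blast
    then show ?thesis
      unfolding cond_L_def \<beta>_def[symmetric] using 1 \<open>0 < M\<close>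
      by (intro exI[of _ M] conjI exI[of _ r0] impI allI) (simp_all add: powr)
  next
    case 2
    then have "\<beta> = 0" using sqrt_exponent_bounds(2)[OF n] by (simp add: \<beta>_def)
    have "\<forall>\<^sub>F t in at_top. c / 2 * t \<le> \<sigma> * w (exp t)"
      using linear_growth_of_increments[OF mono _ \<open>0 < c\<close>] inc \<open>\<beta> = 0\<close> by simp
    then have "\<forall>\<^sub>F t in at_top. c / 2 * t \<le> \<bar>w (exp t)\<bar>"
      by eventually_elim (use le_abs in \<open>blast intro: order_trans\<close>)
    then obtain r0 where "1 \<le> r0" "\<And>r. r0 \<le> r \<Longrightarrow> c / 2 * ln r \<le> \<bar>w r\<bar>"
      using ev[of "\<lambda>t r. c / 2 * t \<le> \<bar>w r\<bar>"] by blast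
    then show ?thesis
      unfolding cond_L_def using 2 \<open>0 < c\<close>
      by (intro exI[of _ "c / 2"] conjI exI[of _ r0] impI allI) simp_all
  next
    case 3
    have "\<forall>\<^sub>F t in at_top. ereal (c * exp (\<beta> * t)) \<le> \<bar>ereal (w (exp t)) - l\<bar>"
      using eventually_ge_at_top[of T0]
    proof eventually_elim
      case (elim t)
      have "ereal (c * exp (\<beta> * t)) \<le> ereal (\<sigma> * w (exp (t + 1)) - \<sigma> * w (exp t))"
        using inc[OF elim] by simp
      also note dist[OF elim]
      finally show ?case .
    qed
    then obtain r0 where "1 \<le> r0"
      "\<And>r. r0 \<le> r \<Longrightarrow> ereal (c * exp (\<beta> * ln r)) \<le> \<bar>ereal (w r) - l\<bar>"
      using ev[of "\<lambda>t r. ereal (c * exp (\<beta> * t)) \<le> \<bar>ereal (w r) - l\<bar>"] by blast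
    then show ?thesis
      unfolding cond_L_def \<beta>_def[symmetric] using 3 \<open>0 < c\<close>
      by (intro exI[of _ c] conjI exI[of _ r0] impI allI) (simp_all add: powr)
  qed
qed

text \<open>For \<open>n = 2\<close> the exponent is 0 and bounded increments add up linearly in
  \<open>t = ln r\<close>; for \<open>n \<ge> 3\<close> they sum geometrically. Times in [0, T0] are
  covered by continuity of \<open>w\<close> up to the boundary.\<close>

lemma cond_S_of_decay:
  assumes n: "2 \<le> n" and "0 \<le> T0" and cw: "continuous_on {1..} w"
    and inc: "\<And>T t. T0 \<le> T \<Longrightarrow> t \<in> {T..T+1} \<Longrightarrow>
      \<bar>w (exp t) - w (exp T)\<bar> \<le> C * exp ((- real n / 2 - sqrt (real n - 1) + 2) * T)"
    and lim: "((\<lambda>t. ereal (w (exp t))) \<longlongrightarrow> l) at_top"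
  shows "cond_S n w l"
proof -
  define \<gamma> where "\<gamma> = - real n / 2 - sqrt (real n - 1) + 2"
  define W where "W t = w (exp t)" for t
  note inc = inc[folded \<gamma>_def W_def]
  have w: "w r = W (ln r)" if "1 \<le> r" for r
    using that by (simp add: W_def)
  have powr: "r powr \<gamma> = exp (\<gamma> * ln r)" if "1 \<le> r" for r
    using that by (simp add: powr_def)
  have "continuous_on {0..T0} W"
    unfolding W_def by (intro continuous_on_compose2[OF cw] continuous_intros) auto
  then obtain B where B: "\<And>t. t \<in> {0..T0} \<Longrightarrow> \<bar>W t\<bar> \<le> B"
    using continuous_bounded_Icc by blast
  have "0 \<le> B" using B[of 0] \<open>0 \<le> T0\<close> by simp
  consider "n = 2" | "3 \<le> n" using n by linarith
  then show ?thesis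
  proof cases
    case 1
    then have \<gamma>: "\<gamma> = 0" using sqrt_exponent_bounds(4)[OF n] by (simp add: \<gamma>_def)
    have "0 \<le> C" using inc[of T0 T0] by (simp add: \<gamma>)
    \<comment> \<open>Since \<open>t \<ge> ln 2\<close>, the constant \<open>B + C\<close> is at
      most \<open>(B + C) / ln 2 * t\<close>; the range \<open>r \<ge> 2\<close> keeps
      \<open>ln r\<close> away from 0.\<close>
    define M where "M = C + (B + C) / ln 2 + 1"
    have "\<bar>W t\<bar> \<le> M * t" if t: "ln 2 \<le> t" for t
    proof -
      have "0 < ln (2::real)" by simp
      then have "0 < t" using t by linarith
      have "(B + C) / ln 2 * ln 2 \<le> (B + C) / ln 2 * t"
        using t \<open>0 \<le> B\<close> \<open>0 \<le> C\<close> by (intro mult_left_mono divide_nonneg_nonneg) auto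
      moreover have "(B + C) / ln 2 * ln 2 = B + C"
        by simp
      moreover have "M * t = C * t + (B + C) / ln 2 * t + t"
        by (simp add: M_def distrib_right)
      ultimately have BC: "C * t + (B + C) \<le> M * t"
        using \<open>0 < t\<close> by linarith
      show ?thesis
      proof (cases "t \<le> T0")
        case True
        then have "\<bar>W t\<bar> \<le> B" using B \<open>0 < t\<close> by simp
        then show ?thesis
          using BC \<open>0 \<le> C\<close> \<open>0 < t\<close> mult_nonneg_nonneg[of C t] by linarith
      next
        case False
        have "\<bar>W t - W T0\<bar> \<le> C * (t - T0 + 1)"
          by (rule linear_bound_of_increments) (use inc False in \<open>auto simp: \<gamma>\<close>)
        also have "\<dots> \<le> C * (t + 1)"
          using \<open>0 \<le> C\<close> \<open>0 \<le> T0\<close> by (intro mult_left_mono) auto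
        finally have "\<bar>W t - W T0\<bar> \<le> C * t + C" by (simp add: algebra_simps)
        moreover have "\<bar>W T0\<bar> \<le> B" using B \<open>0 \<le> T0\<close> by simp
        ultimately show ?thesis using BC by linarith
      qed
    qed
    then have "\<bar>w r\<bar> \<le> M * ln r" if "2 \<le> r" for r
      using that w[of r] by simp
    moreover have "0 < M"
      using \<open>0 \<le> B\<close> \<open>0 \<le> C\<close> unfolding M_def by (intro add_nonneg_pos add_nonneg_nonneg divide_nonneg_nonneg) auto
    ultimately show ?thesis
      unfolding cond_S_def using 1 by (intro exI[of _ M]) simp
  next
    case 2
    then have \<gamma>: "\<gamma> < 0" using sqrt_exponent_bounds(3)[OF n] by (simp add: \<gamma>_def)
    define D where "D = C / (1 - exp \<gamma>)"
    have far: "\<bar>ereal (W T) - l\<bar> \<le> ereal (D * exp (\<gamma> * T))" if "T0 \<le> T" for T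
      unfolding D_def
      by (rule ereal_dist_limit_le[OF lim[folded W_def]], rule exp_decay_of_increments[OF inc \<gamma> that])
    from far[of T0] obtain L where L: "l = ereal L"
      by (cases l) auto
    \<comment> \<open>The middle term serves the times before \<open>T0\<close>, where
      \<open>exp (\<gamma> * (t - T0)) \<ge> 1\<close> because \<open>\<gamma>\<close> is
      negative.\<close>
    define M where "M = \<bar>D\<bar> + (B + \<bar>L\<bar>) * exp (- \<gamma> * T0) + 1"
    have "0 < M"
      using \<open>0 \<le> B\<close> unfolding M_def by (intro add_nonneg_pos add_nonneg_nonneg mult_nonneg_nonneg) auto
    have "\<bar>W t - L\<bar> \<le> M * exp (\<gamma> * t)" if t: "0 \<le> t" for t
    proof (cases "T0 \<le> t")
      case True
      have "0 \<le> (B + \<bar>L\<bar>) * exp (- \<gamma> * T0)"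
        using \<open>0 \<le> B\<close> by simp
      then have "D \<le> M"
        unfolding M_def by linarith
      then have "D * exp (\<gamma> * t) \<le> M * exp (\<gamma> * t)" by simp
      moreover have "\<bar>W t - L\<bar> \<le> D * exp (\<gamma> * t)"
        using far[OF True] by (simp add: L)
      ultimately show ?thesis by linarith
    next
      case False
      then have "\<bar>W t - L\<bar> \<le> B + \<bar>L\<bar>" using B[of t] t by auto
      also have "\<dots> \<le> (B + \<bar>L\<bar>) * exp (\<gamma> * (t - T0))"
        using False \<gamma> \<open>0 \<le> B\<close> mult_left_mono[of 1 "exp (\<gamma> * (t - T0))" "B + \<bar>L\<bar>"]
        by (simp add: mult_nonpos_nonpos)
      also have "\<dots> = (B + \<bar>L\<bar>) * exp (- \<gamma> * T0) * exp (\<gamma> * t)"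
        by (simp add: algebra_simps flip: exp_add)
      also have "\<dots> \<le> M * exp (\<gamma> * t)"
        by (intro mult_right_mono) (auto simp: M_def)
      finally show ?thesis .
    qed
    then have "\<bar>ereal (w r) - l\<bar> \<le> ereal (M * r powr \<gamma>)" if "1 \<le> r" for r
      using that w[of r] by (simp add: L powr)
    then show ?thesis
      unfolding cond_S_def \<gamma>_def[symmetric] using 2 \<open>0 < M\<close> by (intro exI[of _ M]) simp
  qed
qed

theorem theorem1p1:
  fixes f :: "real \<Rightarrow> real"
    and u :: "real ^ 'n \<Rightarrow> real"
    and w :: "real \<Rightarrow> real"
  assumes "CARD('n) \<ge> 2"
    and "f C1_differentiable_on UNIV"
    and radial: "\<And>x. x \<in> - ball 0 1 \<Longrightarrow> u x = w (norm x)"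
    and "classical_solution_on (- ball 0 1) f u"
    and "stable_on (- cball 0 1) f u"
  shows "\<exists>u_inf :: ereal.
           ((\<lambda>r. ereal (w r)) \<longlongrightarrow> u_inf) at_top \<and>
           (cond_L CARD('n) w u_inf \<or> cond_S CARD('n) w u_inf) \<and>
           \<not> (cond_L CARD('n) w u_inf \<and> cond_S CARD('n) w u_inf)"
proof -
  define n where "n = CARD('n)"
  have n: "2 \<le> n" using assms(1) by (simp add: n_def)
  obtain D where D: "\<And>x. (f has_vector_derivative D x) (at x)" "continuous_on UNIV D"
    using assms(2) by (auto simp: C1_differentiable_on_def)
  have df: "(f has_real_derivative D x) (at x)" for x
    using D(1) by (simp add: has_real_derivative_iff_has_vector_derivative)
  have f': "deriv f = D"
    using df by (intro ext DERIV_imp_deriv)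
  obtain p q where cw: "continuous_on {1..} w"
    and dw: "\<And>r. 1 < r \<Longrightarrow> (w has_real_derivative p r) (at r)"
    and dp: "\<And>r. 1 < r \<Longrightarrow> (p has_real_derivative q r) (at r)"
    and ode: "\<And>r. 1 < r \<Longrightarrow> q r + (real n - 1) * (p r / r) = - f (w r)"
    using radial_ode[OF radial assms(4)] unfolding n_def by blast
  have dexp: "(exp has_real_derivative exp t) (at t)" for t :: real
    by (rule DERIV_exp)
  have dW: "((\<lambda>t. w (exp t)) has_real_derivative exp t * p (exp t)) (at t)" if "0 < t" for t
    using DERIV_chain2[OF dw dexp] that by (simp add: mult.commute)
  have dy: "((\<lambda>t. p (exp t)) has_real_derivative exp t * q (exp t)) (at t)" if "0 < t" for t
    using DERIV_chain2[OF dp dexp] that by (simp add: mult.commute)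
  \<comment> \<open>The radial equation multiplied by \<open>r = exp t\<close>.\<close>
  have y': "exp t * q (exp t) = - (real n - 1) * p (exp t) - exp t * f (w (exp t))" if "0 < t" for t
  proof -
    have "exp t * (q (exp t) + (real n - 1) * (p (exp t) / exp t)) = exp t * (- f (w (exp t)))"
      using ode[of "exp t"] that by simp
    moreover have "exp t * ((real n - 1) * (p (exp t) / exp t)) = (real n - 1) * p (exp t)"
      by simp
    ultimately show ?thesis
      by (simp only: distrib_left)
  qed
  have cD: "continuous_on UNIV (deriv f)"
    unfolding f' by (rule D(2))
  have stab: "0 \<le> integral {a..b} (\<lambda>t. exp ((real n - 2) * t) * (z' t)\<^sup>2
      - exp (real n * t) * D (w (exp t)) * (z t)\<^sup>2)"
    if "0 < a" "a < b" "\<And>t. 0 < t \<Longrightarrow> (z has_real_derivative z' t) (at t)"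
      "continuous_on {0<..} z'" "\<And>t. 0 < t \<Longrightarrow> t \<notin> {a..b} \<Longrightarrow> z t = 0" for z z' a b
    unfolding n_def f'[symmetric]
    by (rule radial_stability[where u = u and w = w]) (fact radial assms(5) cw cD that)+
  obtain \<sigma> T0 where T0: "0 < T0" and \<sigma>: "\<bar>\<sigma>\<bar> = 1"
    and pos: "\<And>t. T0 \<le> t \<Longrightarrow> 0 \<le> \<sigma> * (exp t * p (exp t))"
    and alt: "(\<exists>c>0. \<forall>T\<ge>T0. c * exp ((2 - real n / 2 + sqrt (real n - 1)) * T)
            \<le> \<sigma> * (w (exp (T+1)) - w (exp T))) \<or>
        (\<exists>C. \<forall>T\<ge>T0. \<forall>t\<in>{T..T+1}. \<bar>w (exp t) - w (exp T)\<bar>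
            \<le> C * exp ((2 - real n / 2 - sqrt (real n - 1)) * T))"
  proof -
    show ?thesis
      by (rule log_radial_dichotomy[OF n, where W = "\<lambda>t. w (exp t)" and y = "\<lambda>t. p (exp t)"
            and y' = "\<lambda>t. exp t * q (exp t)" and f = f and f' = D])
        (fact dW dy y' df D(2) stab | rule that, assumption+)+
  qed
  have mono: "\<sigma> * w (exp r) \<le> \<sigma> * w (exp t)" if "T0 \<le> r" "r \<le> t" for r t
  proof (rule DERIV_nonneg_imp_nondecreasing[OF that(2)])
    fix x assume "r \<le> x" "x \<le> t"
    then show "\<exists>d. ((\<lambda>t. \<sigma> * w (exp t)) has_real_derivative d) (at x) \<and> 0 \<le> d"
      using pos[of x] DERIV_cmult[OF dW[of x], of \<sigma>] that T0 by fastforce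
  qed
  \<comment> \<open>The limit of the nondecreasing function \<open>\<sigma> * w (exp t)\<close> is
    its supremum; for \<open>\<sigma> = - 1\<close> it is negated.\<close>
  have "\<exists>l. ((\<lambda>t. ereal (w (exp t))) \<longlongrightarrow> l) at_top \<and>
      (\<forall>t\<ge>T0. ereal (\<sigma> * w (exp (t + 1)) - \<sigma> * w (exp t)) \<le> \<bar>ereal (w (exp t)) - l\<bar>)"
  proof -
    obtain l where l: "((\<lambda>t. ereal (\<sigma> * w (exp t))) \<longlongrightarrow> l) at_top"
        "\<And>t. T0 \<le> t \<Longrightarrow> ereal (\<sigma> * w (exp t)) \<le> l"
      using mono_tendsto_ereal[of T0 "\<lambda>t. \<sigma> * w (exp t)"] mono by blast
    \<comment> \<open>The function stays below its limit one unit of time later too, so the coming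
      increment is at most the remaining distance, even if that is infinite.\<close>
    have d: "ereal (\<sigma> * w (exp (t + 1)) - \<sigma> * w (exp t)) \<le> \<bar>ereal (\<sigma> * w (exp t)) - l\<bar>" if "T0 \<le> t" for t
      using l(2)[of "t + 1"] that by (cases l) auto
    consider "\<sigma> = 1" | "\<sigma> = - 1" using \<sigma> by linarith
    then show ?thesis
    proof cases
      case 1
      then show ?thesis using l(1) d by (intro exI[of _ l]) simp
    next
      case 2
      have "((\<lambda>t. - ereal (\<sigma> * w (exp t))) \<longlongrightarrow> - l) at_top"
        using l(1) by (rule tendsto_uminus_ereal)
      moreover have "\<bar>ereal x - - l\<bar> = \<bar>ereal (- x) - l\<bar>" for x
        by (cases l) auto
      ultimately show ?thesis using d 2 by (intro exI[of _ "- l"]) simp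
    qed
  qed
  then obtain l where l: "((\<lambda>t. ereal (w (exp t))) \<longlongrightarrow> l) at_top"
    and dist: "\<And>t. T0 \<le> t \<Longrightarrow> ereal (\<sigma> * w (exp (t + 1)) - \<sigma> * w (exp t)) \<le> \<bar>ereal (w (exp t)) - l\<bar>"
    by blast
  have "((\<lambda>r. ereal (w (exp (ln r)))) \<longlongrightarrow> l) at_top"
    by (rule filterlim_compose[OF l ln_at_top])
  moreover have "\<forall>\<^sub>F r in at_top. ereal (w (exp (ln r))) = ereal (w r)"
    using eventually_gt_at_top[of 0] by eventually_elim simp
  ultimately have lim: "((\<lambda>r. ereal (w r)) \<longlongrightarrow> l) at_top"
    by (rule Lim_transform_eventually)
  have "cond_L n w l \<or> cond_S n w l"
    using alt
  proof (elim disjE exE conjE)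
    fix c :: real
    assume "0 < c" and inc: "\<forall>T\<ge>T0. c * exp ((2 - real n / 2 + sqrt (real n - 1)) * T)
            \<le> \<sigma> * (w (exp (T+1)) - w (exp T))"
    have "2 - real n / 2 + sqrt (real n - 1) = - real n / 2 + sqrt (real n - 1) + 2"
      by simp
    note inc' = inc[unfolded this]
    have "cond_L n w l"
      by (rule cond_L_of_growth[OF n mono \<sigma> \<open>0 < c\<close> _ dist]) (use inc' in \<open>auto simp: right_diff_distrib\<close>)
    then show ?thesis ..
  next
    fix C :: real
    assume inc: "\<forall>T\<ge>T0. \<forall>t\<in>{T..T+1}. \<bar>w (exp t) - w (exp T)\<bar>
            \<le> C * exp ((2 - real n / 2 - sqrt (real n - 1)) * T)"
    have "2 - real n / 2 - sqrt (real n - 1) = - real n / 2 - sqrt (real n - 1) + 2"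
      by simp
    note inc' = inc[unfolded this]
    have "cond_S n w l"
      by (rule cond_S_of_decay[OF n less_imp_le[OF T0] cw _ l, of C]) (use inc' in blast)
    then show ?thesis ..
  qed
  moreover have "\<not> (cond_L n w l \<and> cond_S n w l)"
    using cond_L_cond_S_exclusive[OF n lim] by blast
  ultimately show ?thesis
    using lim unfolding n_def by blast
qed

end
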